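(* Let $B$ be an algebra satisfying condition (A), $S\subset R$ a multiplicatively closed subset, $A=B[S^{-1}]$, and let $U_0\subseteq\mathbb K$ be an $R$-submodule with $B=\{a\in A: a[U_0]\subseteq U_0\}$. Let $L_0\in B$ be locally ad-nilpotent and let $L\in A$ satisfy: (1) there is a $k$-linear subspace $U\subseteq\mathbb K$ with (a) $L[U]\subseteq U$ and (b) $sU_0\subseteq U\subseteq s^{-1}U_0$ for some $s\in S$; (2) $L\in F_0A$ and $\sigma_0(L)=\sigma_0(L_0)$. In addition, assume that $B$ is Noetherian and that the subspace $U$ is maximal, i.e. it is the largest among all subspaces of $\mathbb K$ satisfying (1a) and (1b) (with $s\in S$ allowed to depend on the subspace). Put $$\mathcal M=\{a\in A: a[U_0]\subseteq U\},\qquad \mathcal D=\{a\in A: a[U]\subseteq U\}.$$ Then (a) $\mathcal M$ is a reflexive fractional (right) ideal of $B$; (b) $\mathcal D\cong\mathrm{End}_B(\mathcal M)$, where $\mathrm{End}_B(\mathcal M)$ is the endomorphism ring of the right $B$-module $\mathcal M$.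
   Context: $k$ is a field of characteristic zero; all rings are unital $k$-algebras. Condition (A): $B$ contains a commutative subalgebra $R$, which is a Noetherian domain with quotient field $\mathbb K$, such that $R\subset B\subset\mathcal D(\mathbb K)$, where $\mathcal D(\mathbb K)$ is the ring of $k$-linear algebraic differential operators on $\mathbb K$ and $R\subset\mathcal D(\mathbb K)$ is the natural inclusion. $S$ consists of nonzero elements; then $S$ is a two-sided Ore set in $B$, its elements are units in $\mathcal D(\mathbb K)$, and $A\subset\mathcal D(\mathbb K)$; $a[f]$ denotes the action of $a\in\mathcal D(\mathbb K)$ on $f\in\mathbb K$. Write $\mathrm{ad}_{L_0}(b)=L_0b-bL_0$. $L_0$ is locally ad-nilpotent in $B$ if for every $b\in B$ some power of $\mathrm{ad}_{L_0}$ kills $b$. For $0\ne b\in B$, $\deg_{L_0}(b)$ is the least $m\ge0$ with $\mathrm{ad}_{L_0}^{m+1}(b)=0$, $\deg_{L_0}(0)=-\infty$; on $A$, $\deg(s^{-1}b)=\deg_{L_0}(b)-\deg_{L_0}(s)$ (well defined). $F_mA=\{a\in A:\deg(a)\le m\}$ and $\sigma_0:F_0A\to F_0A/F_{-1}A$ is the quotient map. For a Noetherian domain $B$ with quotient skew-field $\mathcal Q$, a fractional (right) ideal is a right $B$-submodule $\mathcal M\subseteq\mathcal Q$ with $pB\subseteq\mathcal M\subseteq qB$ for some nonzero $p,q\in\mathcal Q$. A right $B$-module $\mathcal M$ is reflexive if the canonical map $\mathcal M\to\mathcal M^{**}$ is an isomorphism, where $\mathcal M^*=\mathrm{Hom}_B(\mathcal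 M,B)$. *)

theory Defs
  imports "HOL-Algebra.Algebra" "HOL-Algebra.Algebraic_Closure_Type" "HOL-Library.Extended_Real"
begin

section \<open>Differential operators on a field\<close>

text \<open>The ground field is a type \<open>'k\<close>, the field \<open>\<K>\<close> a type \<open>'a\<close>, and \<open>scale\<close> is the
  \<open>k\<close>-algebra structure of \<open>\<K>\<close>. Operators are functions \<open>'a \<Rightarrow> 'a\<close>; the action \<open>a[f]\<close> is
  function application and \<open>a[V]\<close> is the image \<open>a ` V\<close>.\<close>

definition k_algebra :: "('k::field \<Rightarrow> 'a::field \<Rightarrow> 'a) \<Rightarrow> bool" where
  "k_algebra scale \<longleftrightarrow>
     vector_space scale \<and> (\<forall>c x y. scale c (x * y) = scale c x * y)"

definition mulop :: "'a::field \<Rightarrow> 'a \<Rightarrow> 'a" where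
  "mulop f = (\<lambda>x. f * x)"

definition op_scale :: "('k::field \<Rightarrow> 'a::field \<Rightarrow> 'a) \<Rightarrow> 'k \<Rightarrow> ('a \<Rightarrow> 'a) \<Rightarrow> 'a \<Rightarrow> 'a" where
  "op_scale scale c P = (\<lambda>x. scale c (P x))"

definition commutator :: "('a::field \<Rightarrow> 'a) \<Rightarrow> ('a \<Rightarrow> 'a) \<Rightarrow> 'a \<Rightarrow> 'a" where
  "commutator P Q = (\<lambda>x. P (Q x) - Q (P x))"

text \<open>Grothendieck's algebraic differential operators of order at most \<open>n\<close>.\<close>

primrec diff_ops :: "('k::field \<Rightarrow> 'a::field \<Rightarrow> 'a) \<Rightarrow> nat \<Rightarrow> ('a \<Rightarrow> 'a) set" where
  "diff_ops scale 0 =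
     {P. Vector_Spaces.linear scale scale P \<and> (\<forall>f. commutator P (mulop f) = (\<lambda>x. 0))}"
| "diff_ops scale (Suc n) =
     {P. Vector_Spaces.linear scale scale P \<and> (\<forall>f. commutator P (mulop f) \<in> diff_ops scale n)}"

definition diff_ring :: "('k::field \<Rightarrow> 'a::field \<Rightarrow> 'a) \<Rightarrow> ('a \<Rightarrow> 'a) ring" where
  "diff_ring scale =
     \<lparr> carrier = (\<Union>n. diff_ops scale n), monoid.mult = (\<circ>), one = id,
       ring.zero = (\<lambda>x. 0), add = (\<lambda>P Q x. P x + Q x) \<rparr>"

abbreviation sub_ring_on ::
  "('k::field \<Rightarrow> 'a::field \<Rightarrow> 'a) \<Rightarrow> ('a \<Rightarrow> 'a) set \<Rightarrow> ('a \<Rightarrow> 'a) ring" where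
  "sub_ring_on scale T \<equiv> (diff_ring scale)\<lparr>carrier := T\<rparr>"


section \<open>Condition (A), localisation, degree filtration\<close>

definition condition_A ::
  "('k::field \<Rightarrow> 'a::field \<Rightarrow> 'a) \<Rightarrow> 'a set \<Rightarrow> ('a \<Rightarrow> 'a) set \<Rightarrow> bool" where
  "condition_A scale R B \<longleftrightarrow>
     subring R (ring_of_type_algebra :: 'a ring) \<and> (\<forall>c. \<forall>r\<in>R. scale c r \<in> R) \<and>
     noetherian_domain ((ring_of_type_algebra :: 'a ring)\<lparr>carrier := R\<rparr>) \<and>
     (\<forall>x. \<exists>a\<in>R. \<exists>b\<in>R - {0}. x = a / b) \<and>
     subring B (diff_ring scale) \<and> (\<forall>c. \<forall>P\<in>B. op_scale scale c P \<in> B) \<and>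
     mulop ` R \<subseteq> B"

definition R_submodule :: "'a::field set \<Rightarrow> 'a set \<Rightarrow> bool" where
  "R_submodule R U \<longleftrightarrow>
     additive_subgroup U (ring_of_type_algebra :: 'a ring) \<and> (\<forall>r\<in>R. \<forall>u\<in>U. r * u \<in> U)"

text \<open>The left fraction \<open>s\<^sup>-\<^sup>1b\<close>, and \<open>B[S\<^sup>-\<^sup>1]\<close> as the set of these. Since \<open>S\<close> is a
  two-sided Ore set in \<open>B\<close>, right fractions give the same set.\<close>

definition left_frac :: "'a::field \<Rightarrow> ('a \<Rightarrow> 'a) \<Rightarrow> 'a \<Rightarrow> 'a" where
  "left_frac s b = mulop (inverse s) \<circ> b"

definition localization :: "'a::field set \<Rightarrow> ('a \<Rightarrow> 'a) set \<Rightarrow> ('a \<Rightarrow> 'a) set" where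
  "localization S B = {left_frac s b | s b. s \<in> S \<and> b \<in> B}"

definition transporter ::
  "('a \<Rightarrow> 'a) set \<Rightarrow> 'a set \<Rightarrow> 'a set \<Rightarrow> ('a \<Rightarrow> 'a) set" where
  "transporter A V W = {a \<in> A. a ` V \<subseteq> W}"

definition locally_ad_nilpotent :: "('a::field \<Rightarrow> 'a) set \<Rightarrow> ('a \<Rightarrow> 'a) \<Rightarrow> bool" where
  "locally_ad_nilpotent B L0 \<longleftrightarrow> (\<forall>b\<in>B. \<exists>n. (commutator L0 ^^ n) b = (\<lambda>x. 0))"

definition ad_deg :: "('a::field \<Rightarrow> 'a) \<Rightarrow> ('a \<Rightarrow> 'a) \<Rightarrow> ereal" where
  "ad_deg L0 b =
     (if b = (\<lambda>x. 0) then -\<infinity>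
      else ereal (real (LEAST m. (commutator L0 ^^ Suc m) b = (\<lambda>x. 0))))"

definition loc_deg ::
  "('a::field \<Rightarrow> 'a) \<Rightarrow> 'a set \<Rightarrow> ('a \<Rightarrow> 'a) set \<Rightarrow> ('a \<Rightarrow> 'a) \<Rightarrow> ereal" where
  "loc_deg L0 S B a =
     (THE d. \<exists>s\<in>S. \<exists>b\<in>B. a = left_frac s b \<and> d = ad_deg L0 b - ad_deg L0 (mulop s))"

definition filt ::
  "('a::field \<Rightarrow> 'a) \<Rightarrow> 'a set \<Rightarrow> ('a \<Rightarrow> 'a) set \<Rightarrow> int \<Rightarrow> ('a \<Rightarrow> 'a) set" where
  "filt L0 S B m = {a \<in> localization S B. loc_deg L0 S B a \<le> ereal (real_of_int m)}"

text \<open>The quotient map \<open>F\<^sub>0A \<rightarrow> F\<^sub>0A/F\<^sub>-\<^sub>1A\<close>; its values are additive cosets.\<close>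

definition sigma0 ::
  "('k::field \<Rightarrow> 'a::field \<Rightarrow> 'a) \<Rightarrow> ('a \<Rightarrow> 'a) \<Rightarrow> 'a set \<Rightarrow> ('a \<Rightarrow> 'a) set
     \<Rightarrow> ('a \<Rightarrow> 'a) \<Rightarrow> ('a \<Rightarrow> 'a) set" where
  "sigma0 scale L0 S B a =
     filt L0 S B (-1) +>\<^bsub>sub_ring_on scale (filt L0 S B 0)\<^esub> a"

text \<open>Conditions (1a) and (1b) on a subspace \<open>U\<close>.\<close>

definition admissible ::
  "('k::field \<Rightarrow> 'a::field \<Rightarrow> 'a) \<Rightarrow> 'a set \<Rightarrow> 'a set \<Rightarrow> ('a \<Rightarrow> 'a) \<Rightarrow> 'a set \<Rightarrow> bool" where
  "admissible scale S U0 L U \<longleftrightarrow>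
     module.subspace scale U \<and> L ` U \<subseteq> U \<and>
     (\<exists>s\<in>S. mulop s ` U0 \<subseteq> U \<and> U \<subseteq> mulop (inverse s) ` U0)"


section \<open>Noetherian rings, one-sided modules, fractional ideals\<close>

definition right_ideal :: "'r set \<Rightarrow> ('r, 'x) ring_scheme \<Rightarrow> bool" where
  "right_ideal I R \<longleftrightarrow>
     additive_subgroup I R \<and> (\<forall>x\<in>I. \<forall>r\<in>carrier R. x \<otimes>\<^bsub>R\<^esub> r \<in> I)"

definition left_ideal :: "'r set \<Rightarrow> ('r, 'x) ring_scheme \<Rightarrow> bool" where
  "left_ideal I R \<longleftrightarrow>
     additive_subgroup I R \<and> (\<forall>x\<in>I. \<forall>r\<in>carrier R. r \<otimes>\<^bsub>R\<^esub> x \<in> I)"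

text \<open>The library's \<open>noetherian_ring\<close> only concerns two-sided ideals.\<close>

definition two_sided_noetherian :: "('r, 'x) ring_scheme \<Rightarrow> bool" where
  "two_sided_noetherian R \<longleftrightarrow>
     (\<forall>I. (\<forall>n::nat. right_ideal (I n) R \<and> I n \<subseteq> I (Suc n)) \<longrightarrow> (\<exists>N. \<forall>n\<ge>N. I n = I N)) \<and>
     (\<forall>I. (\<forall>n::nat. left_ideal (I n) R \<and> I n \<subseteq> I (Suc n)) \<longrightarrow> (\<exists>N. \<forall>n\<ge>N. I n = I N))"

text \<open>One-sided modules use the library's \<^typ>\<open>('r, 'm) module\<close> record, whose fields \<open>mult\<close> and
  \<open>one\<close> play no role. For a right module, \<open>smult b m\<close> stands for \<open>m \<cdot> b\<close>.\<close>

definition right_module ::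
  "('r, 'x) ring_scheme \<Rightarrow> ('r, 'm, 'y) module_scheme \<Rightarrow> bool" where
  "right_module R M \<longleftrightarrow>
     ring R \<and> abelian_group M \<and>
     (\<forall>r\<in>carrier R. \<forall>x\<in>carrier M. r \<odot>\<^bsub>M\<^esub> x \<in> carrier M) \<and>
     (\<forall>r\<in>carrier R. \<forall>s\<in>carrier R. \<forall>x\<in>carrier M.
        (r \<oplus>\<^bsub>R\<^esub> s) \<odot>\<^bsub>M\<^esub> x = r \<odot>\<^bsub>M\<^esub> x \<oplus>\<^bsub>M\<^esub> s \<odot>\<^bsub>M\<^esub> x) \<and>
     (\<forall>r\<in>carrier R. \<forall>x\<in>carrier M. \<forall>y\<in>carrier M.
        r \<odot>\<^bsub>M\<^esub> (x \<oplus>\<^bsub>M\<^esub> y) = r \<odot>\<^bsub>M\<^esub> x \<oplus>\<^bsub>M\<^esub> r \<odot>\<^bsub>M\<^esub> y) \<and>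
     (\<forall>r\<in>carrier R. \<forall>s\<in>carrier R. \<forall>x\<in>carrier M.
        (r \<otimes>\<^bsub>R\<^esub> s) \<odot>\<^bsub>M\<^esub> x = s \<odot>\<^bsub>M\<^esub> (r \<odot>\<^bsub>M\<^esub> x)) \<and>
     (\<forall>x\<in>carrier M. \<one>\<^bsub>R\<^esub> \<odot>\<^bsub>M\<^esub> x = x)"

text \<open>Additive maps commuting with the action: \<open>Hom\<^sub>R(M, N)\<close>, both for right and for left
  modules. Homomorphisms are \<open>undefined\<close> outside the carrier.\<close>

definition module_hom_set ::
  "('r, 'x) ring_scheme \<Rightarrow> ('r, 'm, 'y) module_scheme \<Rightarrow> ('r, 'n, 'z) module_scheme
     \<Rightarrow> ('m \<Rightarrow> 'n) set" where
  "module_hom_set R M N =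
     {f \<in> carrier M \<rightarrow>\<^sub>E carrier N.
        (\<forall>x\<in>carrier M. \<forall>y\<in>carrier M. f (x \<oplus>\<^bsub>M\<^esub> y) = f x \<oplus>\<^bsub>N\<^esub> f y) \<and>
        (\<forall>r\<in>carrier R. \<forall>x\<in>carrier M. f (r \<odot>\<^bsub>M\<^esub> x) = r \<odot>\<^bsub>N\<^esub> f x)}"

definition right_regular :: "('r, 'x) ring_scheme \<Rightarrow> ('r, 'r) module" where
  "right_regular R =
     \<lparr> carrier = carrier R, monoid.mult = monoid.mult R, one = one R,
       ring.zero = ring.zero R, add = add R,
       module.smult = (\<lambda>b x. x \<otimes>\<^bsub>R\<^esub> b) \<rparr>"

definition left_regular :: "('r, 'x) ring_scheme \<Rightarrow> ('r, 'r) module" where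
  "left_regular R =
     \<lparr> carrier = carrier R, monoid.mult = monoid.mult R, one = one R,
       ring.zero = ring.zero R, add = add R,
       module.smult = (\<lambda>b x. b \<otimes>\<^bsub>R\<^esub> x) \<rparr>"

text \<open>The dual of a right module is a left module via \<open>(b\<phi>)(m) = b \<phi>(m)\<close>; the dual of a left
  module is a right module via \<open>(\<psi>b)(\<phi>) = \<psi>(\<phi>) b\<close>.\<close>

definition dual_of_right ::
  "('r, 'x) ring_scheme \<Rightarrow> ('r, 'm, 'y) module_scheme \<Rightarrow> ('r, 'm \<Rightarrow> 'r) module" where
  "dual_of_right R M =
     \<lparr> carrier = module_hom_set R M (right_regular R), monoid.mult = undefined, one = undefined,
       ring.zero = (\<lambda>m\<in>carrier M. \<zero>\<^bsub>R\<^esub>),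
       add = (\<lambda>\<phi> \<psi>. \<lambda>m\<in>carrier M. \<phi> m \<oplus>\<^bsub>R\<^esub> \<psi> m),
       module.smult = (\<lambda>b \<phi>. \<lambda>m\<in>carrier M. b \<otimes>\<^bsub>R\<^esub> \<phi> m) \<rparr>"

definition dual_of_left ::
  "('r, 'x) ring_scheme \<Rightarrow> ('r, 'm, 'y) module_scheme \<Rightarrow> ('r, 'm \<Rightarrow> 'r) module" where
  "dual_of_left R M =
     \<lparr> carrier = module_hom_set R M (left_regular R), monoid.mult = undefined, one = undefined,
       ring.zero = (\<lambda>m\<in>carrier M. \<zero>\<^bsub>R\<^esub>),
       add = (\<lambda>\<phi> \<psi>. \<lambda>m\<in>carrier M. \<phi> m \<oplus>\<^bsub>R\<^esub> \<psi> m),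
       module.smult = (\<lambda>b \<psi>. \<lambda>m\<in>carrier M. \<psi> m \<otimes>\<^bsub>R\<^esub> b) \<rparr>"

definition bidual ::
  "('r, 'x) ring_scheme \<Rightarrow> ('r, 'm, 'y) module_scheme \<Rightarrow> ('r, ('m \<Rightarrow> 'r) \<Rightarrow> 'r) module" where
  "bidual R M = dual_of_left R (dual_of_right R M)"

definition canonical_map ::
  "('r, 'x) ring_scheme \<Rightarrow> ('r, 'm, 'y) module_scheme \<Rightarrow> 'm \<Rightarrow> ('m \<Rightarrow> 'r) \<Rightarrow> 'r" where
  "canonical_map R M =
     (\<lambda>m\<in>carrier M. \<lambda>\<phi>\<in>carrier (dual_of_right R M). \<phi> m)"

definition reflexive_right_module ::
  "('r, 'x) ring_scheme \<Rightarrow> ('r, 'm, 'y) module_scheme \<Rightarrow> bool" where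
  "reflexive_right_module R M \<longleftrightarrow>
     right_module R M \<and>
     canonical_map R M \<in> module_hom_set R M (bidual R M) \<and>
     bij_betw (canonical_map R M) (carrier M) (carrier (bidual R M))"

definition End_ring ::
  "('r, 'x) ring_scheme \<Rightarrow> ('r, 'm, 'y) module_scheme \<Rightarrow> ('m \<Rightarrow> 'm) ring" where
  "End_ring R M =
     \<lparr> carrier = module_hom_set R M M,
       monoid.mult = (\<lambda>f g. compose (carrier M) f g),
       one = (\<lambda>m\<in>carrier M. m),
       ring.zero = (\<lambda>m\<in>carrier M. \<zero>\<^bsub>M\<^esub>),
       add = (\<lambda>f g. \<lambda>m\<in>carrier M. f m \<oplus>\<^bsub>M\<^esub> g m) \<rparr>"

text \<open>A subset \<open>M\<close> of a ring \<open>A\<close>, with right multiplication as action.\<close>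

definition right_mult_module :: "('r, 'x) ring_scheme \<Rightarrow> 'r set \<Rightarrow> ('r, 'r) module" where
  "right_mult_module A M =
     \<lparr> carrier = M, monoid.mult = monoid.mult A, one = one A,
       ring.zero = ring.zero A, add = add A,
       module.smult = (\<lambda>b m. m \<otimes>\<^bsub>A\<^esub> b) \<rparr>"

text \<open>\<open>Q\<close>, with embedding \<open>\<iota>\<close>, is the quotient skew-field of \<open>B\<close>. For a Noetherian domain it
  exists and is unique up to a unique isomorphism over \<open>B\<close>.\<close>

definition quotient_skew_field ::
  "('r, 'x) ring_scheme \<Rightarrow> ('q, 'y) ring_scheme \<Rightarrow> ('r \<Rightarrow> 'q) \<Rightarrow> bool" where
  "quotient_skew_field B Q \<iota> \<longleftrightarrow>
     ring Q \<and> \<one>\<^bsub>Q\<^esub> \<noteq> \<zero>\<^bsub>Q\<^esub> \<and> Units Q = carrier Q - {\<zero>\<^bsub>Q\<^esub>} \<and>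
     \<iota> \<in> ring_hom B Q \<and> inj_on \<iota> (carrier B) \<and>
     (\<forall>q\<in>carrier Q. \<exists>a\<in>carrier B. \<exists>b\<in>carrier B - {\<zero>\<^bsub>B\<^esub>}. q = \<iota> a \<otimes>\<^bsub>Q\<^esub> inv\<^bsub>Q\<^esub> (\<iota> b))"

text \<open>The inclusion of \<open>A = B[S\<^sup>-\<^sup>1]\<close> in \<open>Q\<close>, that is \<open>s\<^sup>-\<^sup>1b \<mapsto> \<iota>(s)\<^sup>-\<^sup>1\<iota>(b)\<close>.\<close>

definition loc_embed ::
  "'a::field set \<Rightarrow> ('a \<Rightarrow> 'a) set \<Rightarrow> ('q, 'y) ring_scheme \<Rightarrow> (('a \<Rightarrow> 'a) \<Rightarrow> 'q)
     \<Rightarrow> ('a \<Rightarrow> 'a) \<Rightarrow> 'q" where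
  "loc_embed S B Q \<iota> a =
     (THE q. \<exists>s\<in>S. \<exists>b\<in>B. a = left_frac s b \<and> q = inv\<^bsub>Q\<^esub> (\<iota> (mulop s)) \<otimes>\<^bsub>Q\<^esub> \<iota> b)"

definition fractional_right_ideal ::
  "('r, 'x) ring_scheme \<Rightarrow> ('q, 'y) ring_scheme \<Rightarrow> ('r \<Rightarrow> 'q) \<Rightarrow> 'q set \<Rightarrow> bool" where
  "fractional_right_ideal B Q \<iota> N \<longleftrightarrow>
     additive_subgroup N Q \<and> (\<forall>n\<in>N. \<forall>b\<in>carrier B. n \<otimes>\<^bsub>Q\<^esub> \<iota> b \<in> N) \<and>
     (\<exists>p\<in>carrier Q - {\<zero>\<^bsub>Q\<^esub>}. \<exists>q\<in>carrier Q - {\<zero>\<^bsub>Q\<^esub>}.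
        (\<lambda>b. p \<otimes>\<^bsub>Q\<^esub> \<iota> b) ` carrier B \<subseteq> N \<and> N \<subseteq> (\<lambda>b. q \<otimes>\<^bsub>Q\<^esub> \<iota> b) ` carrier B)"

end

theory Submission
  imports Defs
begin

text \<open>
  Since \<open>ad\<close> of a function is nilpotent on differential operators, \<open>S\<close> is an Ore set, and a
  \<open>B\<close>-linear map \<open>\<phi>\<close> on \<open>M \<ni> s\<close> is left multiplication by \<open>\<phi>(s)s\<^sup>-\<^sup>1 \<in> A\<close>. Thus the dual, the bidual
  and the endomorphisms of \<open>\<M>\<close> become subsets of \<open>A\<close>. Reflexivity: \<open>L\<M> \<subseteq> \<M>\<close> gives \<open>LN \<subseteq> N\<close>
  for the bidual \<open>N\<close>, so the span of \<open>N[U\<^sub>0]\<close> is admissible and by maximality lies in \<open>U\<close>.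

  Endomorphisms: differential operators form a domain, so \<open>deg\<close> is additive on products in \<open>A\<close>, and
  \<open>ad\<close> of \<open>L\<close> lowers it because \<open>L - L\<^sub>0 \<in> F\<^sub>-\<^sub>1A\<close>. The endomorphisms \<open>a\<close> of \<open>\<M>\<close> satisfy \<open>s a s \<in> B\<close>,
  which bounds their degree below; hence \<open>ad\<^sub>L\<^sup>n(a) = 0\<close> for some \<open>n\<close>. As
  \<open>L ad\<^sub>L\<^sup>j(a) = ad\<^sub>L\<^sup>j\<^sup>+\<^sup>1(a) + ad\<^sub>L\<^sup>j(a) L\<close>, the subspace generated by \<open>U\<close> and the finitely many
  nonzero \<open>ad\<^sub>L\<^sup>j(a)[U]\<close> is admissible, so \<open>a[U] \<subseteq> U\<close>.
\<close>

section \<open>Iterated commutators\<close>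

lemma additive_mulop: "additive (mulop f)"
  by (simp add: additive_def mulop_def algebra_simps)

lemma additive_commutator:
  fixes P Q :: "'a::field \<Rightarrow> 'a"
  assumes "additive P" "additive Q"
  shows "additive (commutator P Q)"
  using assms by (simp add: additive_def commutator_def)

lemma additive_ad:
  fixes T P :: "'a::field \<Rightarrow> 'a"
  assumes "additive T" "additive P"
  shows "additive ((commutator T ^^ n) P)"
  using assms by (induct n) (simp_all add: additive_commutator)

lemma additive_of_nat:
  fixes P :: "'a::field \<Rightarrow> 'a"
  assumes "additive P"
  shows "P (of_nat n * x) = of_nat n * P x"
  using assms by (induct n) (simp_all add: additive.zero additive.add algebra_simps)

text \<open>\<open>commutator T\<close> is a derivation for composition. The outer factor
  \<open>P\<close> is applied to the difference \<open>T (Q x) - Q (T x)\<close> and has to split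
  it, hence its additivity.\<close>

lemma commutator_comp:
  fixes T P Q :: "'a::field \<Rightarrow> 'a"
  assumes "additive P"
  shows "commutator T (P \<circ> Q) = (\<lambda>x. (commutator T P \<circ> Q) x + (P \<circ> commutator T Q) x)"
  using assms by (simp add: commutator_def additive.diff)

lemma commutator_add:
  fixes T P Q :: "'a::field \<Rightarrow> 'a"
  assumes "additive T"
  shows "commutator T (\<lambda>x. P x + Q x) = (\<lambda>x. commutator T P x + commutator T Q x)"
  using assms by (simp add: commutator_def additive.add algebra_simps)

lemma commutator_zero: "additive T \<Longrightarrow> commutator T (\<lambda>x. 0) = (\<lambda>x. 0)"
  by (simp add: commutator_def additive.zero)

lemma ad_add:
  fixes T P Q :: "'a::field \<Rightarrow> 'a"
  assumes "additive T"
  shows "(commutator T ^^ n) (\<lambda>x. P x + Q x) =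
    (\<lambda>x. (commutator T ^^ n) P x + (commutator T ^^ n) Q x)"
  using assms by (induct n) (simp_all add: commutator_add)

lemma ad_zero: "additive T \<Longrightarrow> (commutator T ^^ n) (\<lambda>x. 0) = (\<lambda>x. 0)"
  by (induct n) (simp_all add: commutator_zero)

lemma ad_zero_mono:
  assumes "additive T" "(commutator T ^^ n) P = (\<lambda>x. 0)" "n \<le> m"
  shows "(commutator T ^^ m) P = (\<lambda>x. 0)"
proof -
  have "(commutator T ^^ m) P = (commutator T ^^ (m - n)) ((commutator T ^^ n) P)"
    using assms(3) by (metis comp_apply funpow_add le_add_diff_inverse2)
  then show ?thesis using assms by (simp add: ad_zero)
qed

text \<open>Leibniz' rule for the iterated commutator has terms
  \<open>ad^i P \<circ> ad^(p+q-i) Q\<close> with binomial weights, and the bounds on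
  \<open>P\<close> and \<open>Q\<close> kill all of them except \<open>i = p\<close>. Induction on
  \<open>p + q\<close> reaches this term by removing one derivation at a time.\<close>

lemma ad_comp_top:
  fixes T P Q :: "'a::field \<Rightarrow> 'a"
  assumes "additive T" "additive P" "additive Q"
    and "(commutator T ^^ Suc p) P = (\<lambda>x. 0)" "(commutator T ^^ Suc q) Q = (\<lambda>x. 0)"
  shows "(commutator T ^^ (p + q)) (P \<circ> Q) =
    (\<lambda>x. of_nat ((p + q) choose p) * ((commutator T ^^ p) P \<circ> (commutator T ^^ q) Q) x)"
  using assms(2-5)
proof (induct n \<equiv> "p + q" arbitrary: p q P Q rule: less_induct)
  case less
  let ?d = "commutator T"
  note T = \<open>additive T\<close>
  note aP = additive_commutator[OF T \<open>additive P\<close>] and aQ = additive_commutator[OF T \<open>additive Q\<close>]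
  show ?case
  proof (cases p)
    case p0: 0
    then have dP: "?d P = (\<lambda>x. 0)" using less.prems by simp
    show ?thesis
    proof (cases q)
      case 0
      with p0 show ?thesis by (simp add: comp_def)
    next
      case (Suc q')
      \<comment> \<open>With \<open>p = 0\<close> the operator \<open>P\<close> commutes with
        \<open>T\<close>, so every derivation falls on \<open>Q\<close>.\<close>
      have "?d (P \<circ> Q) = P \<circ> ?d Q"
        unfolding commutator_comp[OF \<open>additive P\<close>] dP by (simp add: comp_def)
      then have "(?d ^^ q) (P \<circ> Q) = (?d ^^ q') (P \<circ> ?d Q)"
        using Suc by (simp add: funpow_swap1)
      also have "\<dots> = (\<lambda>x. of_nat ((0 + q') choose 0) * ((?d ^^ 0) P \<circ> (?d ^^ q') (?d Q)) x)"
        using less.hyps[of 0 q' P "?d Q"] Suc p0 less.prems aQ by (simp add: funpow_swap1)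
      finally show ?thesis using p0 Suc by (simp add: funpow_swap1)
    qed
  next
    case (Suc p')
    note p = Suc
    show ?thesis
    proof (cases q)
      case 0
      then have dQ: "?d Q = (\<lambda>x. 0)" using less.prems by simp
      have "?d (P \<circ> Q) = ?d P \<circ> Q"
        unfolding commutator_comp[OF \<open>additive P\<close>] dQ
        by (simp add: comp_def additive.zero[OF \<open>additive P\<close>])
      then have "(?d ^^ p) (P \<circ> Q) = (?d ^^ p') (?d P \<circ> Q)"
        using p by (simp add: funpow_swap1)
      also have "\<dots> = (\<lambda>x. of_nat ((p' + 0) choose p') * ((?d ^^ p') (?d P) \<circ> (?d ^^ 0) Q) x)"
        using less.hyps[of p' 0 "?d P" Q] 0 p less.prems aP by (simp add: funpow_swap1)
      finally show ?thesis using p 0 by (simp add: funpow_swap1)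
    next
      case (Suc q')
      have 1: "(?d ^^ (p' + q)) (?d P \<circ> Q) = (\<lambda>x. of_nat ((p' + q) choose p') *
          ((?d ^^ p) P \<circ> (?d ^^ q) Q) x)"
        using less.hyps[of p' q "?d P" Q] Suc p less.prems aP by (simp add: funpow_swap1)
      have 2: "(?d ^^ (p + q')) (P \<circ> ?d Q) = (\<lambda>x. of_nat ((p + q') choose p) *
          ((?d ^^ p) P \<circ> (?d ^^ q) Q) x)"
        using less.hyps[of p q' P "?d Q"] Suc p less.prems aQ by (simp add: funpow_swap1)
      have "(?d ^^ (p + q)) (P \<circ> Q) = (?d ^^ (p' + q)) (?d (P \<circ> Q))"
        using p by (simp add: funpow_swap1)
      also have "\<dots> = (\<lambda>x. (?d ^^ (p' + q)) (?d P \<circ> Q) x + (?d ^^ (p + q')) (P \<circ> ?d Q) x)"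
        using Suc p by (simp only: commutator_comp[OF \<open>additive P\<close>] ad_add[OF T])
          (simp only: plus_nat.simps add_Suc_right)
      \<comment> \<open>Pascal's rule adds the coefficients \<open>(p' + q) choose p'\<close> and
        \<open>(p + q') choose p\<close>, where \<open>p = Suc p'\<close> and
        \<open>q = Suc q'\<close>.\<close>
      also have "\<dots> = (\<lambda>x. of_nat ((p + q) choose p) * ((?d ^^ p) P \<circ> (?d ^^ q) Q) x)"
        unfolding 1 2 using Suc p by (simp add: algebra_simps)
      finally show ?thesis .
    qed
  qed
qed

text \<open>After \<open>p + q\<close> commutators there remains a natural multiple of a product
  whose two factors commute with \<open>T\<close>, so one more commutator gives zero.\<close>

lemma ad_comp_vanish:
  fixes T P Q :: "'a::field \<Rightarrow> 'a"
  assumes "additive T" "additive P" "additive Q"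
    and "(commutator T ^^ Suc p) P = (\<lambda>x. 0)" "(commutator T ^^ Suc q) Q = (\<lambda>x. 0)"
  shows "(commutator T ^^ Suc (p + q)) (P \<circ> Q) = (\<lambda>x. 0)"
proof -
  have "commutator T (\<lambda>x. of_nat n * (P' \<circ> Q') x) = (\<lambda>x. 0)"
    if "additive P'" "commutator T P' = (\<lambda>x. 0)" "commutator T Q' = (\<lambda>x. 0)" for n P' Q'
  proof -
    have "commutator T (P' \<circ> Q') = (\<lambda>x. 0)"
      unfolding commutator_comp[OF that(1)] using that by (simp add: additive.zero comp_def)
    moreover have "commutator T (\<lambda>x. of_nat n * (P' \<circ> Q') x) = (\<lambda>x. of_nat n * commutator T (P' \<circ> Q') x)"
      by (simp add: commutator_def additive_of_nat[OF \<open>additive T\<close>] algebra_simps)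
    ultimately show ?thesis by simp
  qed
  then show ?thesis
    using assms additive_ad[OF assms(1,2)] by (simp add: ad_comp_top[OF assms])
qed

section \<open>Order of ad-nilpotency and its additivity\<close>

definition ad_order :: "('a::field \<Rightarrow> 'a) \<Rightarrow> ('a \<Rightarrow> 'a) \<Rightarrow> nat" where
  "ad_order T P = (LEAST m. (commutator T ^^ Suc m) P = (\<lambda>x. 0))"

lemma ad_order:
  assumes "additive T" "P \<noteq> (\<lambda>x. 0)" "(commutator T ^^ n) P = (\<lambda>x. 0)"
  shows "(commutator T ^^ Suc (ad_order T P)) P = (\<lambda>x. 0)"
    and "(commutator T ^^ ad_order T P) P \<noteq> (\<lambda>x. 0)"
proof -
  have "(commutator T ^^ Suc n) P = (\<lambda>x. 0)"
    using ad_zero_mono[OF assms(1,3)] le_Suc_eq by blast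
  then show "(commutator T ^^ Suc (ad_order T P)) P = (\<lambda>x. 0)"
    unfolding ad_order_def by (rule LeastI)
  show "(commutator T ^^ ad_order T P) P \<noteq> (\<lambda>x. 0)"
  proof (cases "ad_order T P")
    case 0
    then show ?thesis using assms by simp
  next
    case (Suc m)
    then show ?thesis using not_less_Least[of m "\<lambda>m. (commutator T ^^ Suc m) P = (\<lambda>x. 0)"]
      unfolding ad_order_def by simp
  qed
qed

lemma ad_order_le:
  assumes "(commutator T ^^ Suc m) P = (\<lambda>x. 0)"
  shows "ad_order T P \<le> m"
  unfolding ad_order_def using assms by (rule Least_le)

lemma ad_order_eqI:
  assumes "additive T" "(commutator T ^^ Suc m) P = (\<lambda>x. 0)" "(commutator T ^^ m) P \<noteq> (\<lambda>x. 0)"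
  shows "ad_order T P = m"
proof (rule antisym)
  show "ad_order T P \<le> m" using assms(2) by (rule ad_order_le)
  have "P \<noteq> (\<lambda>x. 0)" using assms ad_zero by metis
  then have "(commutator T ^^ Suc (ad_order T P)) P = (\<lambda>x. 0)"
    using ad_order(1) assms by blast
  then show "m \<le> ad_order T P"
    using ad_zero_mono[OF assms(1)] assms(3) by (meson not_less_eq_eq)
qed

text \<open>That the product of the leading terms is nonzero stays a hypothesis, so that the lemma
  serves twice: with a multiplication operator as \<open>T\<close> in the proof that there are no
  zero divisors, and with \<open>L0\<close> as \<open>T\<close> once this is known. Characteristic
  zero keeps the binomial coefficient from vanishing.\<close>

lemma ad_order_comp:
  fixes T P Q :: "'a::field \<Rightarrow> 'a"
  assumes "additive T" "additive P" "additive Q" "P \<noteq> (\<lambda>x. 0)" "Q \<noteq> (\<lambda>x. 0)"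
    and "(commutator T ^^ m) P = (\<lambda>x. 0)" "(commutator T ^^ n) Q = (\<lambda>x. 0)"
    and char_0: "\<And>i. i > 0 \<Longrightarrow> of_nat i \<noteq> (0::'a)"
    and "(commutator T ^^ ad_order T P) P \<circ> (commutator T ^^ ad_order T Q) Q \<noteq> (\<lambda>x. 0)"
  shows "ad_order T (P \<circ> Q) = ad_order T P + ad_order T Q"
    and "P \<circ> Q \<noteq> (\<lambda>x. 0)"
proof -
  let ?p = "ad_order T P" and ?q = "ad_order T Q"
  note P = ad_order[OF assms(1,4,6)] and Q = ad_order[OF assms(1,5,7)]
  have ne: "(commutator T ^^ (?p + ?q)) (P \<circ> Q) \<noteq> (\<lambda>x. 0)"
    unfolding ad_comp_top[OF assms(1-3) P(1) Q(1)]
    using assms(9) char_0[of "(?p + ?q) choose ?p"] by (auto simp: fun_eq_iff)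
  then show "ad_order T (P \<circ> Q) = ?p + ?q"
    using ad_comp_vanish[OF assms(1-3) P(1) Q(1)] assms(1) by (intro ad_order_eqI)
  show "P \<circ> Q \<noteq> (\<lambda>x. 0)" using ne ad_zero[OF assms(1)] by metis
qed

section \<open>Differential operators form a domain\<close>

lemma linear_imp_additive: "Vector_Spaces.linear s1 s2 f \<Longrightarrow> additive f"
  by (simp add: additive_def Vector_Spaces.linear_iff)

lemma linear_uminus:
  "Vector_Spaces.linear s1 s2 f \<Longrightarrow> Vector_Spaces.linear s1 s2 (\<lambda>x. - f x)"
  unfolding Vector_Spaces.linear_iff
  using module.scale_minus_right[of s2] by (auto simp: module_iff_vector_space)

lemma diff_ops_linear: "P \<in> diff_ops scale n \<Longrightarrow> Vector_Spaces.linear scale scale P"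
  by (cases n) auto

lemma diff_ops_uminus:
  "P \<in> diff_ops scale n \<Longrightarrow> (\<lambda>x. - P x) \<in> diff_ops scale n"
proof (induct n arbitrary: P)
  case 0
  then have lin: "Vector_Spaces.linear scale scale (\<lambda>x. - P x)"
    by (intro linear_uminus) (rule diff_ops_linear)
  moreover have "commutator (\<lambda>x. - P x) (mulop f) = (\<lambda>x. - commutator P (mulop f) x)" for f
    by (simp add: commutator_def mulop_def)
  ultimately show ?case using 0 by simp
next
  case (Suc n)
  then have lin: "Vector_Spaces.linear scale scale (\<lambda>x. - P x)"
    by (intro linear_uminus) (rule diff_ops_linear)
  moreover have "commutator (\<lambda>x. - P x) (mulop f) = (\<lambda>x. - commutator P (mulop f) x)" for f
    by (simp add: commutator_def mulop_def)
  ultimately show ?case using Suc by simp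
qed

lemma commutator_swap: "commutator P Q = (\<lambda>x. - commutator Q P x)"
  by (simp add: commutator_def)

lemma diff_ops_ad_mulop:
  assumes "P \<in> diff_ops scale n" "p \<le> n"
  shows "(commutator (mulop f) ^^ p) P \<in> diff_ops scale (n - p)"
  using assms(2)
proof (induct p)
  case 0
  then show ?case using assms(1) by simp
next
  case (Suc p)
  then have "(commutator (mulop f) ^^ p) P \<in> diff_ops scale (Suc (n - Suc p))"
    by (simp add: Suc_diff_Suc)
  \<comment> \<open>\<open>diff_ops\<close> brackets with the function on the right, the iterated
    commutator has it on the left; \<open>diff_ops_uminus\<close> absorbs the sign.\<close>
  then show ?case
    by (subst funpow.simps(2), subst comp_apply, subst commutator_swap)
      (intro diff_ops_uminus, simp)
qed

text \<open>After \<open>n\<close> brackets the order is \<open>0\<close>, and operators of order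
  \<open>0\<close> commute with every function.\<close>

lemma diff_ops_ad_mulop_zero:
  assumes "P \<in> diff_ops scale n"
  shows "(commutator (mulop f) ^^ Suc n) P = (\<lambda>x. 0)"
proof -
  have "(commutator (mulop f) ^^ n) P \<in> diff_ops scale 0"
    using diff_ops_ad_mulop[OF assms order.refl] by simp
  then show ?thesis using commutator_swap[of "mulop f" "(commutator (mulop f) ^^ n) P"] by simp
qed

text \<open>Such an operator satisfies \<open>P f = P (f * 1) = f * P 1\<close>.\<close>

lemma commutes_with_mulops:
  assumes "\<And>f. commutator (mulop f) P = (\<lambda>x. 0)"
  shows "P = mulop (P 1)"
proof
  fix f
  show "P f = mulop (P 1) f"
    using fun_cong[OF assms[of f], of 1] by (simp add: commutator_def mulop_def mult.commute)
qed

text \<open>Taking the leading terms of \<open>P\<close> and \<open>Q\<close> with respect to \<open>ad\<close> of a function that does not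
  commute with both of them lowers the total order, and by Leibniz' rule the leading term of
  \<open>P \<circ> Q\<close> is a nonzero multiple of their product.\<close>

lemma diff_ops_comp_nonzero:
  fixes scale :: "'k::field \<Rightarrow> 'a::field \<Rightarrow> 'a"
  assumes char_0: "\<And>i. i > 0 \<Longrightarrow> of_nat i \<noteq> (0::'a)"
    and "P \<in> diff_ops scale m" "Q \<in> diff_ops scale n" "P \<noteq> (\<lambda>x. 0)" "Q \<noteq> (\<lambda>x. 0)"
  shows "P \<circ> Q \<noteq> (\<lambda>x. 0)"
  using assms(2-5)
proof (induct "m + n" arbitrary: m n P Q rule: less_induct)
  case less
  show ?case
  proof (cases "\<exists>f. commutator (mulop f) P \<noteq> (\<lambda>x. 0) \<or> commutator (mulop f) Q \<noteq> (\<lambda>x. 0)")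
    case True
    then obtain f where f: "commutator (mulop f) P \<noteq> (\<lambda>x. 0) \<or> commutator (mulop f) Q \<noteq> (\<lambda>x. 0)"
      by blast
    let ?d = "commutator (mulop f)" and ?p = "ad_order (mulop f) P" and ?q = "ad_order (mulop f) Q"
    note zP = diff_ops_ad_mulop_zero[OF less.prems(1), of f]
    note zQ = diff_ops_ad_mulop_zero[OF less.prems(2), of f]
    note P = ad_order[OF additive_mulop less.prems(3) zP]
    note Q = ad_order[OF additive_mulop less.prems(4) zQ]
    have le: "?p \<le> m" "?q \<le> n" using ad_order_le zP zQ by blast+
    have "?p \<noteq> 0 \<or> ?q \<noteq> 0" using f P(1) Q(1) by auto
    then have "(m - ?p) + (n - ?q) < m + n" using le by linarith
    then have "(?d ^^ ?p) P \<circ> (?d ^^ ?q) Q \<noteq> (\<lambda>x. 0)"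
      using less.hyps diff_ops_ad_mulop[OF less.prems(1) le(1)]
        diff_ops_ad_mulop[OF less.prems(2) le(2)] P(2) Q(2) by blast
    note top = this
    have add: "additive P" "additive Q"
      by (rule linear_imp_additive[OF diff_ops_linear], fact less.prems)+
    show ?thesis
      using ad_order_comp(2)[OF additive_mulop add less.prems(3,4) zP zQ _ top] char_0 by simp
  next
    case False
    \<comment> \<open>Both operators are now multiplications by nonzero field elements, and their
      product does not kill \<open>1\<close>.\<close>
    then have "P = mulop (P 1)" "Q = mulop (Q 1)" using commutes_with_mulops by blast+
    then obtain g h where gh: "P = mulop g" "Q = mulop h" by blast
    with less.prems have "g \<noteq> 0" "h \<noteq> 0" by (auto simp: mulop_def)
    then have "(P \<circ> Q) 1 \<noteq> 0" by (simp add: gh mulop_def)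
    then show ?thesis by (simp add: fun_eq_iff) blast
  qed
qed

lemma diff_ring_simps:
  fixes scale :: "'k::field \<Rightarrow> 'a::field \<Rightarrow> 'a"
  shows
  "P \<otimes>\<^bsub>diff_ring scale\<^esub> Q = P \<circ> Q"
  "P \<oplus>\<^bsub>diff_ring scale\<^esub> Q = (\<lambda>x. P x + Q x)"
  "\<one>\<^bsub>diff_ring scale\<^esub> = id"
  "\<zero>\<^bsub>diff_ring scale\<^esub> = (\<lambda>x. 0)"
  by (simp_all add: diff_ring_def)

section \<open>Ore localisation\<close>

lemma mulop_comp_mulop: "mulop f \<circ> mulop g = mulop (f * g)"
  by (simp add: mulop_def fun_eq_iff mult.assoc)

lemma mulop_one: "mulop 1 = id"
  by (simp add: mulop_def fun_eq_iff)

lemma mulop_cancel: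
  assumes "s \<noteq> 0"
  shows "mulop (inverse s) \<circ> (mulop s \<circ> P) = P" "mulop s \<circ> (mulop (inverse s) \<circ> P) = P"
    "(P \<circ> mulop s) \<circ> mulop (inverse s) = P" "(P \<circ> mulop (inverse s)) \<circ> mulop s = P"
  using assms by (simp_all add: mulop_def fun_eq_iff mult.assoc[symmetric])

lemma mulop_comp_eq_iff:
  fixes P Q :: "'a::field \<Rightarrow> 'a"
  shows "s \<noteq> 0 \<Longrightarrow> mulop s \<circ> P = mulop s \<circ> Q \<longleftrightarrow> P = Q"
  by (simp add: mulop_def fun_eq_iff)

lemma comp_mulop_eq_iff:
  fixes P Q :: "'a::field \<Rightarrow> 'a"
  assumes "s \<noteq> 0"
  shows "P \<circ> mulop s = Q \<circ> mulop s \<longleftrightarrow> P = Q"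
proof
  assume "P \<circ> mulop s = Q \<circ> mulop s"
  then have "(P \<circ> mulop s) \<circ> mulop (inverse s) = (Q \<circ> mulop s) \<circ> mulop (inverse s)" by simp
  then show "P = Q" unfolding mulop_cancel(3)[OF assms] .
qed simp

lemma mulop_comp_zero_iff: "s \<noteq> 0 \<Longrightarrow> mulop s \<circ> P = (\<lambda>x. 0) \<longleftrightarrow> P = (\<lambda>x. 0)"
  by (auto simp: mulop_def fun_eq_iff)

lemma mulop_zero_iff: "mulop s = (\<lambda>x. 0) \<longleftrightarrow> s = 0"
  by (auto simp: mulop_def fun_eq_iff dest: spec[of _ 1])

text \<open>Induction on the order gives an explicit denominator. Operators of order
  \<open>0\<close> commute with \<open>s\<close>. In general \<open>C = P s - s P\<close> has
  smaller order, and if \<open>s^(n+1) C = Q s\<close>, then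
  \<open>s^(n+2) P = (s^(n+1) P - Q) s\<close>.\<close>

lemma left_ore_mulop:
  assumes "P \<in> diff_ops scale n" "P \<in> B" "mulop s \<in> B" "id \<in> B"
    and comp: "\<And>P Q. P \<in> B \<Longrightarrow> Q \<in> B \<Longrightarrow> P \<circ> Q \<in> B"
    and add: "\<And>P Q. P \<in> B \<Longrightarrow> Q \<in> B \<Longrightarrow> (\<lambda>x. P x + Q x) \<in> B"
    and neg: "\<And>P. P \<in> B \<Longrightarrow> (\<lambda>x. - P x) \<in> B"
  shows "\<exists>Q\<in>B. mulop (s ^ Suc n) \<circ> P = Q \<circ> mulop s"
  using assms(1,2)
proof (induct n arbitrary: P)
  case 0
  then have "commutator P (mulop s) = (\<lambda>x. 0)" by simp
  then have "mulop s \<circ> P = P \<circ> mulop s" by (auto simp: commutator_def fun_eq_iff)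
  then show ?case using 0 by auto
next
  case (Suc n)
  let ?C = "commutator P (mulop s)"
  have pow: "mulop (s ^ k) \<in> B" for k
    using \<open>id \<in> B\<close> comp[OF \<open>mulop s \<in> B\<close>, of "mulop (s ^ k)" for k]
    by (induct k) (simp_all add: mulop_one mulop_comp_mulop)
  have "?C = (\<lambda>x. (P \<circ> mulop s) x + - (mulop s \<circ> P) x)"
    by (simp add: commutator_def)
  then have "?C \<in> B" using add[OF comp neg[OF comp]] Suc.prems(2) \<open>mulop s \<in> B\<close> by simp
  moreover have "?C \<in> diff_ops scale n" using Suc.prems by simp
  ultimately obtain Q where Q: "Q \<in> B" "mulop (s ^ Suc n) \<circ> ?C = Q \<circ> mulop s"
    using Suc.hyps by blast
  let ?Q = "\<lambda>x. (mulop (s ^ Suc n) \<circ> P) x + - Q x"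
  have "s ^ Suc n * (P (s * x) - s * P x) = Q (s * x)" for x
    using fun_cong[OF Q(2), of x] unfolding commutator_def mulop_def comp_def .
  then have "s ^ Suc (Suc n) * P x = s ^ Suc n * P (s * x) - Q (s * x)" for x
  proof -
    have "s ^ Suc (Suc n) * P x = s ^ Suc n * P (s * x) - s ^ Suc n * (P (s * x) - s * P x)"
      by (simp add: algebra_simps)
    then show ?thesis using \<open>s ^ Suc n * (P (s * x) - s * P x) = Q (s * x)\<close> by simp
  qed
  then have "mulop (s ^ Suc (Suc n)) \<circ> P = ?Q \<circ> mulop s"
    unfolding mulop_def comp_def by simp
  moreover have "?Q \<in> B" by (intro add comp neg pow Q(1) Suc.prems(2))
  ultimately show ?case by blast
qed

text \<open>The mirror image of \<open>left_ore_mulop\<close>: if \<open>C s^(n+1) = s Q\<close> for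
  \<open>C = P s - s P\<close>, then \<open>P s^(n+2) = s (Q + P s^(n+1))\<close>.\<close>

lemma right_ore_mulop:
  assumes "P \<in> diff_ops scale n" "P \<in> B" "mulop s \<in> B" "id \<in> B"
    and comp: "\<And>P Q. P \<in> B \<Longrightarrow> Q \<in> B \<Longrightarrow> P \<circ> Q \<in> B"
    and add: "\<And>P Q. P \<in> B \<Longrightarrow> Q \<in> B \<Longrightarrow> (\<lambda>x. P x + Q x) \<in> B"
    and neg: "\<And>P. P \<in> B \<Longrightarrow> (\<lambda>x. - P x) \<in> B"
  shows "\<exists>Q\<in>B. P \<circ> mulop (s ^ Suc n) = mulop s \<circ> Q"
  using assms(1,2)
proof (induct n arbitrary: P)
  case 0
  then have "commutator P (mulop s) = (\<lambda>x. 0)" by simp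
  then have "P \<circ> mulop s = mulop s \<circ> P" by (auto simp: commutator_def fun_eq_iff)
  then show ?case using 0 by auto
next
  case (Suc n)
  let ?C = "commutator P (mulop s)"
  have pow: "mulop (s ^ k) \<in> B" for k
    using \<open>id \<in> B\<close> comp[OF \<open>mulop s \<in> B\<close>, of "mulop (s ^ k)" for k]
    by (induct k) (simp_all add: mulop_one mulop_comp_mulop)
  have "?C = (\<lambda>x. (P \<circ> mulop s) x + - (mulop s \<circ> P) x)"
    by (simp add: commutator_def)
  then have "?C \<in> B" using add[OF comp neg[OF comp]] Suc.prems(2) \<open>mulop s \<in> B\<close> by simp
  moreover have "?C \<in> diff_ops scale n" using Suc.prems by simp
  ultimately obtain Q where Q: "Q \<in> B" "?C \<circ> mulop (s ^ Suc n) = mulop s \<circ> Q"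
    using Suc.hyps by blast
  let ?Q = "\<lambda>x. Q x + (P \<circ> mulop (s ^ Suc n)) x"
  have "P (s * (s ^ Suc n * x)) - s * P (s ^ Suc n * x) = s * Q x" for x
    using fun_cong[OF Q(2), of x] unfolding commutator_def mulop_def comp_def .
  then have "P (s * (s ^ Suc n * x)) = s * Q x + s * P (s ^ Suc n * x)" for x
    by (simp only: diff_eq_eq)
  then have "P \<circ> mulop (s ^ Suc (Suc n)) = mulop s \<circ> ?Q"
    by (simp only: fun_eq_iff comp_apply mulop_def mult.assoc distrib_left power_Suc[of s "Suc n"]
        simp_thms)
  moreover have "?Q \<in> B" by (intro add comp pow Q(1) Suc.prems(2))
  ultimately show ?case by blast
qed

section \<open>The localisation as a ring of operators\<close>

locale ore_setting =
  fixes scale :: "'k::field \<Rightarrow> 'a::field \<Rightarrow> 'a" and S :: "'a set" and B :: "('a \<Rightarrow> 'a) set"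
  assumes vector_space: "vector_space scale"
    and scale_mult: "scale c (x * y) = scale c x * y"
    and B_linear: "P \<in> B \<Longrightarrow> Vector_Spaces.linear scale scale P"
    and B_id: "id \<in> B"
    and B_comp: "P \<in> B \<Longrightarrow> Q \<in> B \<Longrightarrow> P \<circ> Q \<in> B"
    and B_add: "P \<in> B \<Longrightarrow> Q \<in> B \<Longrightarrow> (\<lambda>x. P x + Q x) \<in> B"
    and B_scale: "P \<in> B \<Longrightarrow> op_scale scale c P \<in> B"
    and S_one: "1 \<in> S" and S_mult: "s \<in> S \<Longrightarrow> t \<in> S \<Longrightarrow> s * t \<in> S"
    and S_nonzero: "s \<in> S \<Longrightarrow> s \<noteq> 0" and S_B: "s \<in> S \<Longrightarrow> mulop s \<in> B"
    and left_ore: "P \<in> B \<Longrightarrow> s \<in> S \<Longrightarrow> \<exists>t\<in>S. \<exists>Q\<in>B. mulop t \<circ> P = Q \<circ> mulop s"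
    and right_ore: "P \<in> B \<Longrightarrow> s \<in> S \<Longrightarrow> \<exists>t\<in>S. \<exists>Q\<in>B. P \<circ> mulop t = mulop s \<circ> Q"
begin

sublocale vs: vector_space scale
  by (rule vector_space)

abbreviation A :: "('a \<Rightarrow> 'a) set" where
  "A \<equiv> localization S B"

text \<open>Elements of \<open>S\<close> act invertibly on the field, so a fraction is an actual
  operator and no equivalence classes arise: membership means that some left denominator clears
  it.\<close>

lemma mem_loc_iff: "a \<in> A \<longleftrightarrow> (\<exists>s\<in>S. mulop s \<circ> a \<in> B)"
proof
  assume "a \<in> A"
  then obtain s b where s: "s \<in> S" "b \<in> B" "a = left_frac s b"
    unfolding localization_def by blast
  then have "mulop s \<circ> a = b" unfolding left_frac_def by (simp only: mulop_cancel(2)[OF S_nonzero])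
  with s(2) have "mulop s \<circ> a \<in> B" by (simp only:)
  then show "\<exists>s\<in>S. mulop s \<circ> a \<in> B" using s(1) by (rule bexI)
next
  assume "\<exists>s\<in>S. mulop s \<circ> a \<in> B"
  then obtain s where s: "s \<in> S" "mulop s \<circ> a \<in> B" by blast
  then have "a = left_frac s (mulop s \<circ> a)"
    unfolding left_frac_def by (simp only: mulop_cancel(1)[OF S_nonzero])
  with s show "a \<in> A" unfolding localization_def by blast
qed

lemma locI: "s \<in> S \<Longrightarrow> mulop s \<circ> a \<in> B \<Longrightarrow> a \<in> A"
  using mem_loc_iff by blast

lemma left_frac_eq_iff: "s \<in> S \<Longrightarrow> a = left_frac s b \<longleftrightarrow> mulop s \<circ> a = b"
  unfolding left_frac_def by (metis mulop_cancel(1,2)[OF S_nonzero])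

lemma B_additive: "P \<in> B \<Longrightarrow> additive P"
  using B_linear linear_imp_additive by blast

lemma B_subset_loc: "P \<in> B \<Longrightarrow> P \<in> A"
  using locI[OF S_one] by (simp add: mulop_one)

lemma S_comp_B: "t \<in> S \<Longrightarrow> mulop s \<circ> a \<in> B \<Longrightarrow> mulop (t * s) \<circ> a \<in> B"
  using B_comp[OF S_B] by (simp add: mulop_comp_mulop[symmetric] comp_assoc)

text \<open>Elements of \<open>S\<close> commute with each other, so the product of the individual
  denominators clears every member of \<open>F\<close>.\<close>

lemma common_denominator:
  assumes "finite F" "F \<subseteq> A"
  shows "\<exists>s\<in>S. \<forall>a\<in>F. mulop s \<circ> a \<in> B"
  using assms
proof (induct F)
  case empty
  then show ?case using S_one by blast
next
  case (insert a F)
  then obtain s where s: "s \<in> S" "\<And>b. b \<in> F \<Longrightarrow> mulop s \<circ> b \<in> B" by blast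
  obtain t where t: "t \<in> S" "mulop t \<circ> a \<in> B" using insert.prems mem_loc_iff by blast
  have "mulop (t * s) \<circ> b \<in> B" if "b \<in> insert a F" for b
    using that S_comp_B[OF s(1) t(2)] S_comp_B[OF t(1) s(2)] by (metis insertE mult.commute)
  then show ?case using S_mult[OF t(1) s(1)] by blast
qed

lemma B_zero: "(\<lambda>x. 0) \<in> B"
  using B_scale[OF B_id, of 0] by (simp add: op_scale_def)

lemma loc_linear:
  assumes "a \<in> A"
  shows "Vector_Spaces.linear scale scale a"
proof -
  obtain s b where sb: "s \<in> S" "b \<in> B" "a = left_frac s b"
    using assms by (auto simp: localization_def)
  have "Vector_Spaces.linear scale scale (mulop (inverse s))"
    using vector_space scale_mult
    by (simp add: Vector_Spaces.linear_iff mulop_def distrib_left) (metis mult.commute)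
  then show ?thesis
    using B_linear[OF sb(2)] Vector_Spaces.linear_compose unfolding sb(3) left_frac_def by blast
qed

lemma loc_additive: "a \<in> A \<Longrightarrow> additive a"
  using loc_linear linear_imp_additive by blast

lemma loc_add:
  assumes "a \<in> A" "b \<in> A"
  shows "(\<lambda>x. a x + b x) \<in> A"
proof -
  obtain s where s: "s \<in> S" "mulop s \<circ> a \<in> B" "mulop s \<circ> b \<in> B"
    using common_denominator[of "{a, b}"] assms by auto
  have "mulop s \<circ> (\<lambda>x. a x + b x) = (\<lambda>x. (mulop s \<circ> a) x + (mulop s \<circ> b) x)"
    by (simp add: mulop_def fun_eq_iff distrib_left)
  then show ?thesis using locI[OF s(1)] B_add[OF s(2,3)] by simp
qed

lemma loc_scale:
  assumes "a \<in> A"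
  shows "op_scale scale c a \<in> A"
proof -
  obtain s where s: "s \<in> S" "mulop s \<circ> a \<in> B" using assms mem_loc_iff by blast
  have "mulop s \<circ> op_scale scale c a = op_scale scale c (mulop s \<circ> a)"
    using scale_mult by (simp add: mulop_def op_scale_def fun_eq_iff) (metis mult.commute)
  then show ?thesis using locI[OF s(1)] B_scale[OF s(2)] by simp
qed

lemma op_scale_minus_one: "op_scale scale (-1) P = (\<lambda>x. - P x)"
  by (simp add: op_scale_def fun_eq_iff)

lemma loc_uminus: "a \<in> A \<Longrightarrow> (\<lambda>x. - a x) \<in> A"
  using loc_scale[of a "-1"] by (simp add: op_scale_minus_one)

lemma B_uminus: "P \<in> B \<Longrightarrow> (\<lambda>x. - P x) \<in> B"
  using B_scale[of P "-1"] by (simp add: op_scale_minus_one)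

lemma B_commutator: "P \<in> B \<Longrightarrow> Q \<in> B \<Longrightarrow> commutator P Q \<in> B"
  using B_add[OF B_comp[of P Q] B_uminus[OF B_comp[of Q P]]] by (simp add: commutator_def comp_def)

lemma B_ad: "T \<in> B \<Longrightarrow> P \<in> B \<Longrightarrow> (commutator T ^^ n) P \<in> B"
  by (induct n) (simp_all add: B_commutator)

lemma loc_comp:
  assumes "a \<in> A" "b \<in> A"
  shows "a \<circ> b \<in> A"
proof -
  obtain s t where s: "s \<in> S" "mulop s \<circ> a \<in> B" and t: "t \<in> S" "mulop t \<circ> b \<in> B"
    using assms mem_loc_iff by blast
  \<comment> \<open>The left Ore condition moves the denominator \<open>t\<close> of
    \<open>b\<close> past \<open>s a\<close>, and \<open>r * s\<close> becomes a denominator of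
    \<open>a \<circ> b\<close>.\<close>
  obtain r Q where r: "r \<in> S" "Q \<in> B" "mulop r \<circ> (mulop s \<circ> a) = Q \<circ> mulop t"
    using left_ore[OF s(2) t(1)] by blast
  have "mulop (r * s) \<circ> (a \<circ> b) = Q \<circ> (mulop t \<circ> b)"
    using r(3) by (simp add: mulop_comp_mulop[symmetric] fun_eq_iff)
  then show ?thesis using locI[OF S_mult[OF r(1) s(1)]] B_comp[OF r(2) t(2)] by simp
qed

lemma loc_commutator: "a \<in> A \<Longrightarrow> b \<in> A \<Longrightarrow> commutator a b \<in> A"
  using loc_add[OF loc_comp[of a b] loc_uminus[OF loc_comp[of b a]]]
  by (simp add: commutator_def comp_def)

lemma loc_ad: "a \<in> A \<Longrightarrow> b \<in> A \<Longrightarrow> (commutator a ^^ n) b \<in> A"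
  by (induct n) (simp_all add: loc_commutator)

lemma mulop_inverse_loc: "s \<in> S \<Longrightarrow> mulop (inverse s) \<in> A"
  using locI[of s "mulop (inverse s)"] S_nonzero[of s] B_id
  by (simp add: mulop_comp_mulop mulop_one)

text \<open>The right Ore condition turns a left fraction into a right one: in
  \<open>s a t = s Q\<close> the invertible \<open>s\<close> cancels.\<close>

lemma right_denominator:
  assumes "a \<in> A"
  shows "\<exists>t\<in>S. a \<circ> mulop t \<in> B"
proof -
  obtain s where s: "s \<in> S" "mulop s \<circ> a \<in> B" using assms mem_loc_iff by blast
  obtain t Q where t: "t \<in> S" "Q \<in> B" "(mulop s \<circ> a) \<circ> mulop t = mulop s \<circ> Q"
    using right_ore[OF s(2,1)] by blast
  then have "a \<circ> mulop t = Q"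
    using mulop_comp_eq_iff[OF S_nonzero[OF s(1)]] by (simp add: comp_assoc)
  with t show ?thesis by blast
qed

end

section \<open>The degree on the localisation\<close>

text \<open>\<open>T\<close> stands for \<open>L0\<close>. The absence of zero divisors is assumed
  here and supplied by \<open>diff_ops_comp_nonzero\<close> when the locale is interpreted.\<close>

locale degree_setting = ore_setting scale S B
  for scale :: "'k::field \<Rightarrow> 'a::field \<Rightarrow> 'a" and S B +
  fixes T :: "'a \<Rightarrow> 'a"
  assumes T_B: "T \<in> B"
    and ad_nilpotent: "locally_ad_nilpotent B T"
    and domain: "P \<in> B \<Longrightarrow> Q \<in> B \<Longrightarrow> P \<noteq> (\<lambda>x. 0) \<Longrightarrow> Q \<noteq> (\<lambda>x. 0) \<Longrightarrow> P \<circ> Q \<noteq> (\<lambda>x. 0)"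
    and char_0: "i > 0 \<Longrightarrow> of_nat i \<noteq> (0::'a)"
begin

lemma T_additive: "additive T"
  by (rule B_additive[OF T_B])

lemma ad_order_B:
  assumes "P \<in> B" "P \<noteq> (\<lambda>x. 0)"
  shows "(commutator T ^^ Suc (ad_order T P)) P = (\<lambda>x. 0)"
    and "(commutator T ^^ ad_order T P) P \<noteq> (\<lambda>x. 0)"
  using ad_nilpotent assms ad_order[OF T_additive] unfolding locally_ad_nilpotent_def by blast+

lemma ad_order_comp_B:
  assumes "P \<in> B" "P \<noteq> (\<lambda>x. 0)" "Q \<in> B" "Q \<noteq> (\<lambda>x. 0)"
  shows "ad_order T (P \<circ> Q) = ad_order T P + ad_order T Q"
proof -
  \<comment> \<open>The leading terms lie in \<open>B\<close> because \<open>T\<close> does, so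
    \<open>domain\<close> applies to them.\<close>
  have "(commutator T ^^ ad_order T P) P \<circ> (commutator T ^^ ad_order T Q) Q \<noteq> (\<lambda>x. 0)"
    using domain B_ad[OF T_B] ad_order_B assms by simp
  then show ?thesis
    using ad_order_comp(1)[OF T_additive B_additive[OF assms(1)] B_additive[OF assms(3)] assms(2,4)
        ad_order_B(1)[OF assms(1,2)] ad_order_B(1)[OF assms(3,4)] char_0] by blast
qed

lemma ad_order_add_B:
  assumes "P \<in> B" "Q \<in> B" "P \<noteq> (\<lambda>x. 0)" "Q \<noteq> (\<lambda>x. 0)"
  shows "ad_order T (\<lambda>x. P x + Q x) \<le> max (ad_order T P) (ad_order T Q)"
proof (rule ad_order_le)
  let ?m = "max (ad_order T P) (ad_order T Q)"
  have "(commutator T ^^ Suc ?m) P = (\<lambda>x. 0)" "(commutator T ^^ Suc ?m) Q = (\<lambda>x. 0)"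
    using ad_order_B(1) assms by (meson ad_zero_mono[OF T_additive] Suc_le_mono max.cobounded1 max.cobounded2)+
  then show "(commutator T ^^ Suc ?m) (\<lambda>x. P x + Q x) = (\<lambda>x. 0)"
    using ad_add[OF T_additive, of "Suc ?m" P Q] by simp
qed

lemma ad_order_commutator_less:
  assumes "P \<in> B" "commutator T P \<noteq> (\<lambda>x. 0)"
  shows "ad_order T (commutator T P) < ad_order T P"
proof -
  have nz: "P \<noteq> (\<lambda>x. 0)" using assms commutator_zero[OF T_additive] by auto
  note 1 = ad_order_B(1)[OF assms(1) nz]
  with assms(2) obtain m where m: "ad_order T P = Suc m" by (cases "ad_order T P") auto
  have "(commutator T ^^ Suc m) (commutator T P) = (\<lambda>x. 0)"
    using 1 unfolding m by (simp add: funpow_swap1)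
  then show ?thesis using ad_order_le m by fastforce
qed

text \<open>An integer-valued form of \<open>loc_deg\<close>, computed from an arbitrarily chosen
  denominator; \<open>deg_eq\<close> shows that for nonzero operators in \<open>A\<close> the choice
  does not matter.\<close>

definition deg :: "('a \<Rightarrow> 'a) \<Rightarrow> int" where
  "deg a = (let s = SOME s. s \<in> S \<and> mulop s \<circ> a \<in> B
            in int (ad_order T (mulop s \<circ> a)) - int (ad_order T (mulop s)))"

lemma mulop_S_nonzero: "s \<in> S \<Longrightarrow> mulop s \<noteq> (\<lambda>x. 0)"
  using S_nonzero mulop_zero_iff by blast

lemma mulop_comp_nonzero: "s \<in> S \<Longrightarrow> a \<noteq> (\<lambda>x. 0) \<Longrightarrow> mulop s \<circ> a \<noteq> (\<lambda>x. 0)"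
  using S_nonzero mulop_comp_zero_iff by blast

lemma deg_eq:
  assumes "a \<noteq> (\<lambda>x. 0)" "s \<in> S" "mulop s \<circ> a \<in> B"
  shows "deg a = int (ad_order T (mulop s \<circ> a)) - int (ad_order T (mulop s))"
proof -
  define t where "t = (SOME s. s \<in> S \<and> mulop s \<circ> a \<in> B)"
  have t: "t \<in> S" "mulop t \<circ> a \<in> B"
    using someI[of "\<lambda>s. s \<in> S \<and> mulop s \<circ> a \<in> B", OF conjI[OF assms(2,3)]] by (simp_all add: t_def)
  \<comment> \<open>The two denominators commute, and additivity of the order in \<open>B\<close>
    turns this identity into equality of the two differences.\<close>
  have "mulop t \<circ> (mulop s \<circ> a) = mulop s \<circ> (mulop t \<circ> a)"
    by (simp add: mulop_def fun_eq_iff mult.left_commute)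
  then have "ad_order T (mulop t) + ad_order T (mulop s \<circ> a) =
      ad_order T (mulop s) + ad_order T (mulop t \<circ> a)"
    using ad_order_comp_B[OF S_B mulop_S_nonzero _ mulop_comp_nonzero] assms t by metis
  then show ?thesis unfolding deg_def t_def[symmetric] Let_def by linarith
qed

lemma deg_B:
  assumes "P \<in> B" "P \<noteq> (\<lambda>x. 0)"
  shows "deg P = int (ad_order T P)"
proof -
  have "ad_order T (id::'a \<Rightarrow> 'a) = 0"
    using T_additive by (intro ad_order_eqI) (auto simp: commutator_def fun_eq_iff intro: exI[of _ 1])
  then show ?thesis using deg_eq[OF assms(2) S_one] assms(1) by (simp add: mulop_one)
qed

lemma deg_comp:
  assumes "a \<in> A" "b \<in> A" "a \<noteq> (\<lambda>x. 0)" "b \<noteq> (\<lambda>x. 0)"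
  shows "a \<circ> b \<noteq> (\<lambda>x. 0)" "deg (a \<circ> b) = deg a + deg b"
proof -
  obtain s t where s: "s \<in> S" "mulop s \<circ> a \<in> B" and t: "t \<in> S" "mulop t \<circ> b \<in> B"
    using assms mem_loc_iff by blast
  obtain r Q where r: "r \<in> S" "Q \<in> B" "mulop r \<circ> (mulop s \<circ> a) = Q \<circ> mulop t"
    using left_ore[OF s(2) t(1)] by blast
  have eq: "mulop (r * s) \<circ> (a \<circ> b) = Q \<circ> (mulop t \<circ> b)"
    using r(3) by (simp add: mulop_comp_mulop[symmetric] fun_eq_iff)
  have sa: "mulop s \<circ> a \<noteq> (\<lambda>x. 0)" and tb: "mulop t \<circ> b \<noteq> (\<lambda>x. 0)"
    using mulop_comp_nonzero s t assms by blast+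
  have "Q \<circ> mulop t \<noteq> (\<lambda>x. 0)"
    using mulop_comp_nonzero[OF r(1) sa] r(3) by simp
  then have Q: "Q \<noteq> (\<lambda>x. 0)" by auto
  have Qtb: "Q \<circ> (mulop t \<circ> b) \<noteq> (\<lambda>x. 0)" using domain r(2) t(2) Q tb by blast
  then have "mulop (r * s) \<circ> (a \<circ> b) \<noteq> (\<lambda>x. 0)" by (simp only: eq not_False_eq_True)
  then show nz: "a \<circ> b \<noteq> (\<lambda>x. 0)" by (auto simp: mulop_def)
  have rs: "r * s \<in> S" using S_mult r s by blast
  have "deg (a \<circ> b) = int (ad_order T (Q \<circ> (mulop t \<circ> b))) - int (ad_order T (mulop (r * s)))"
    using deg_eq[OF nz rs] B_comp[OF r(2) t(2)] unfolding eq by simp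
  moreover have "ad_order T (Q \<circ> (mulop t \<circ> b)) = ad_order T Q + ad_order T (mulop t \<circ> b)"
    using ad_order_comp_B r(2) Q t(2) tb by blast
  moreover have "ad_order T (mulop (r * s)) = ad_order T (mulop r) + ad_order T (mulop s)"
    using ad_order_comp_B[OF S_B mulop_S_nonzero S_B mulop_S_nonzero] r(1) s(1)
    by (simp add: mulop_comp_mulop[symmetric])
  \<comment> \<open>Comparing orders in \<open>r (s a) = Q t\<close> eliminates the order of the
    auxiliary \<open>Q\<close>.\<close>
  moreover have "ad_order T (mulop r) + ad_order T (mulop s \<circ> a) = ad_order T Q + ad_order T (mulop t)"
    using ad_order_comp_B[OF S_B[OF r(1)] mulop_S_nonzero[OF r(1)] s(2) sa]
      ad_order_comp_B[OF r(2) Q S_B[OF t(1)] mulop_S_nonzero[OF t(1)]] r(3) by simp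
  ultimately show "deg (a \<circ> b) = deg a + deg b"
    using deg_eq[OF assms(3) s] deg_eq[OF assms(4) t] by linarith
qed

definition deg_le :: "('a \<Rightarrow> 'a) \<Rightarrow> int \<Rightarrow> bool" where
  "deg_le a m \<longleftrightarrow> a = (\<lambda>x. 0) \<or> deg a \<le> m"

lemma deg_le_comp:
  assumes "a \<in> A" "b \<in> A" "deg_le a m" "deg_le b n"
  shows "deg_le (a \<circ> b) (m + n)"
proof (cases "a = (\<lambda>x. 0) \<or> b = (\<lambda>x. 0)")
  case True
  then have "a \<circ> b = (\<lambda>x. 0)"
    using additive.zero[OF loc_additive[OF assms(1)]] by (auto simp: fun_eq_iff)
  then show ?thesis by (simp add: deg_le_def)
next
  case False
  then show ?thesis using assms deg_comp(2)[OF assms(1,2)] by (auto simp: deg_le_def)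
qed

lemma deg_le_add:
  assumes "a \<in> A" "b \<in> A" "deg_le a m" "deg_le b m"
  shows "deg_le (\<lambda>x. a x + b x) m"
proof -
  let ?c = "\<lambda>x. a x + b x"
  consider "a = (\<lambda>x. 0)" | "b = (\<lambda>x. 0)" | "?c = (\<lambda>x. 0)"
    | "a \<noteq> (\<lambda>x. 0)" "b \<noteq> (\<lambda>x. 0)" "?c \<noteq> (\<lambda>x. 0)" by blast
  then show ?thesis
  proof cases
    case 4
    obtain s where s: "s \<in> S" "mulop s \<circ> a \<in> B" "mulop s \<circ> b \<in> B"
      using common_denominator[of "{a, b}"] assms by auto
    have eq: "mulop s \<circ> ?c = (\<lambda>x. (mulop s \<circ> a) x + (mulop s \<circ> b) x)"
      by (simp add: mulop_def fun_eq_iff distrib_left)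
    have "ad_order T (mulop s \<circ> ?c) \<le> max (ad_order T (mulop s \<circ> a)) (ad_order T (mulop s \<circ> b))"
      unfolding eq using ad_order_add_B[OF s(2,3)] mulop_comp_nonzero s(1) 4 by blast
    moreover have "mulop s \<circ> ?c \<in> B" unfolding eq by (rule B_add[OF s(2,3)])
    ultimately show ?thesis
      using deg_eq[OF _ s(1)] s 4 assms(3,4) unfolding deg_le_def by fastforce
  qed (use assms in \<open>auto simp: deg_le_def\<close>)
qed

lemma deg_le_uminus:
  assumes "a \<in> A" "deg_le a m"
  shows "deg_le (\<lambda>x. - a x) m"
proof -
  \<comment> \<open>Negation is composition with the negative of the identity, an element of
    \<open>B\<close> of degree zero.\<close>
  have eq: "(\<lambda>x. - a x) = (\<lambda>x. - x) \<circ> a" by auto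
  have m: "(\<lambda>x::'a. - x) \<in> B" using B_uminus[OF B_id] by simp
  have "ad_order T (\<lambda>x::'a. - x) = 0"
    using T_additive by (intro ad_order_eqI) (auto simp: commutator_def additive.minus fun_eq_iff intro: exI[of _ 1])
  moreover have "(\<lambda>x::'a. - x) \<noteq> (\<lambda>x. 0)" by (auto simp: fun_eq_iff intro: exI[of _ 1])
  ultimately have "deg_le (\<lambda>x. - x) 0" using deg_B[OF m] by (simp add: deg_le_def)
  from deg_le_comp[OF B_subset_loc[OF m] assms(1) this assms(2)] show ?thesis by (simp add: eq)
qed

lemma deg_le_commutator:
  assumes "a \<in> A" "b \<in> A" "deg_le a m" "deg_le b n"
  shows "deg_le (commutator a b) (m + n)"
proof -
  have "commutator a b = (\<lambda>x. (a \<circ> b) x + - (b \<circ> a) x)" by (simp add: commutator_def)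
  moreover have "deg_le (a \<circ> b) (m + n)" "deg_le (b \<circ> a) (m + n)"
    using deg_le_comp assms by (metis add.commute)+
  ultimately show ?thesis
    using deg_le_add deg_le_uminus loc_comp loc_uminus assms(1,2) by metis
qed

text \<open>If \<open>a = s\<^sup>-\<^sup>1b\<close>, then \<open>s [T, a] = [T, b] - [T, s] a\<close>.\<close>

lemma deg_le_ad_T:
  assumes "a \<in> A" "deg_le a m"
  shows "deg_le (commutator T a) (m - 1)"
proof (cases "a = (\<lambda>x. 0) \<or> commutator T a = (\<lambda>x. 0)")
  case True
  then show ?thesis using commutator_zero[OF T_additive] by (auto simp: deg_le_def)
next
  case False
  obtain s where s: "s \<in> S" "mulop s \<circ> a \<in> B" using assms(1) mem_loc_iff by blast
  \<comment> \<open>Inside \<open>B\<close> the loss of one degree is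
    \<open>ad_order_commutator_less\<close>; it is applied to the numerator and to the denominator
    of \<open>a\<close>.\<close>
  have drop: "deg_le (commutator T P) (deg P - 1)" if "P \<in> B" for P
  proof (cases "commutator T P = (\<lambda>x. 0)")
    case False
    then have "P \<noteq> (\<lambda>x. 0)" using commutator_zero[OF T_additive] by auto
    with False show ?thesis
      using ad_order_commutator_less[OF that] deg_B[OF that] deg_B[OF B_commutator[OF T_B that]]
      by (auto simp: deg_le_def)
  qed (simp add: deg_le_def)
  note sA = B_subset_loc[OF S_B[OF s(1)]] and snz = mulop_S_nonzero[OF s(1)]
  have da: "commutator T a \<in> A" using loc_commutator B_subset_loc[OF T_B] assms(1) by blast
  have ds: "commutator T (mulop s) \<in> A" using B_subset_loc B_commutator T_B S_B s(1) by blast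
  have eq: "mulop s \<circ> commutator T a =
      (\<lambda>x. commutator T (mulop s \<circ> a) x + - (commutator T (mulop s) \<circ> a) x)"
    by (simp add: commutator_comp[OF additive_mulop] fun_eq_iff)
  have "deg (mulop s \<circ> a) = deg (mulop s) + deg a"
    using deg_comp(2) sA assms(1) snz False by blast
  then have 1: "deg_le (commutator T (mulop s \<circ> a)) (deg (mulop s) + deg a - 1)"
    using drop[OF s(2)] by simp
  have "deg_le (commutator T (mulop s) \<circ> a) (deg (mulop s) - 1 + deg a)"
    using deg_le_comp[OF ds assms(1) drop[OF S_B[OF s(1)]], of "deg a"] by (simp add: deg_le_def)
  then have 2: "deg_le (\<lambda>x. - (commutator T (mulop s) \<circ> a) x) (deg (mulop s) + deg a - 1)"
    using deg_le_uminus[OF loc_comp[OF ds assms(1)]] by (simp add: algebra_simps)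
  have "deg_le (mulop s \<circ> commutator T a) (deg (mulop s) + deg a - 1)"
    unfolding eq
    using deg_le_add[OF _ _ 1 2] B_subset_loc[OF B_commutator[OF T_B s(2)]]
      loc_uminus[OF loc_comp[OF ds assms(1)]] by blast
  then have "deg (mulop s) + deg (commutator T a) \<le> deg (mulop s) + deg a - 1"
    using deg_comp[OF sA da snz] False unfolding deg_le_def by auto
  then show ?thesis using assms(2) False unfolding deg_le_def by auto
qed

text \<open>The commutator with \<open>L\<close> is the sum of those with \<open>T\<close> and with
  \<open>L - T\<close>. The first lowers the degree by \<open>deg_le_ad_T\<close>, the second
  because \<open>L - T\<close> has degree at most \<open>-1\<close>.\<close>

lemma deg_le_ad:
  assumes "L \<in> A" "deg_le (\<lambda>x. L x - T x) (-1)" "a \<in> A" "deg_le a m"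
  shows "deg_le ((commutator L ^^ n) a) (m - int n)"
proof (induct n)
  case 0
  then show ?case using assms by simp
next
  case (Suc n)
  let ?a = "(commutator L ^^ n) a" and ?x = "\<lambda>x. L x - T x"
  have aA: "?a \<in> A" using loc_ad assms by blast
  have xA: "?x \<in> A" using loc_add[OF assms(1) loc_uminus[OF B_subset_loc[OF T_B]]] by simp
  have "commutator L ?a = (\<lambda>y. commutator T ?a y + commutator ?x ?a y)"
    using additive.diff[OF loc_additive[OF aA]] by (simp add: commutator_def fun_eq_iff)
  moreover have "deg_le (commutator T ?a) (m - int n - 1)"
    by (rule deg_le_ad_T[OF aA Suc])
  moreover have "deg_le (commutator ?x ?a) (m - int n - 1)"
    using deg_le_commutator[OF xA aA assms(2) Suc] by (simp add: algebra_simps)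
  ultimately show ?case
    using deg_le_add[of "commutator T ?a" "commutator ?x ?a"] loc_commutator[OF xA aA]
      loc_commutator[OF B_subset_loc[OF T_B] aA] by (simp add: algebra_simps)
qed

text \<open>Nonzero elements of \<open>B\<close> have nonnegative degree, so a nonzero operator
  sandwiched into \<open>B\<close> by \<open>s\<close> has degree at least
  \<open>- 2 * deg (mulop s)\<close>. Repeated brackets with \<open>L\<close> would fall below this
  bound.\<close>

lemma ad_eventually_zero:
  assumes "L \<in> A" "deg_le (\<lambda>x. L x - T x) (-1)" "a \<in> A" "s \<in> S"
    and bounded: "\<And>n. mulop s \<circ> (commutator L ^^ n) a \<circ> mulop s \<in> B"
  shows "\<exists>n. (commutator L ^^ n) a = (\<lambda>x. 0)"
proof (rule ccontr)
  assume nz: "\<nexists>n. (commutator L ^^ n) a = (\<lambda>x. 0)"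
  \<comment> \<open>This many brackets make \<open>deg a - ?n + 2 * deg (mulop s)\<close> negative;
    if \<open>nat\<close> truncates, the sum is negative already at \<open>?n = 0\<close>.\<close>
  let ?n = "nat (deg a + 2 * deg (mulop s) + 1)"
  let ?a = "(commutator L ^^ ?n) a"
  note sA = B_subset_loc[OF S_B[OF assms(4)]] and snz = mulop_S_nonzero[OF assms(4)]
  have aA: "?a \<in> A" using loc_ad assms by blast
  have an: "?a \<noteq> (\<lambda>x. 0)" using nz by blast
  have "deg_le ?a (deg a - int ?n)"
    by (rule deg_le_ad[OF assms(1-3)]) (simp add: deg_le_def)
  then have 1: "deg ?a \<le> deg a - int ?n" using nz unfolding deg_le_def by blast
  note sa = deg_comp[OF sA aA snz an]
  note sas = deg_comp[OF loc_comp[OF sA aA] sA sa(1) snz]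
  have "deg (mulop s \<circ> ?a \<circ> mulop s) \<ge> 0" using deg_B[OF bounded sas(1)] by linarith
  then show False using 1 sa(2) sas(2) by linarith
qed

end

section \<open>Agreement with the degree and the filtration of the definitions\<close>

context degree_setting
begin

lemma ad_deg_B: "P \<in> B \<Longrightarrow> P \<noteq> (\<lambda>x. 0) \<Longrightarrow> ad_deg T P = ereal (real (ad_order T P))"
  by (simp add: ad_deg_def ad_order_def)

text \<open>By \<open>deg_eq\<close> all fractions representing \<open>a\<close> give the same
  difference, so the description by \<open>THE\<close> in \<open>loc_deg\<close> is proper.\<close>

lemma loc_deg_eq:
  assumes "a \<in> A" "a \<noteq> (\<lambda>x. 0)"
  shows "loc_deg T S B a = ereal (real_of_int (deg a))"
  unfolding loc_deg_def
proof (rule the_equality)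
  have deg: "ad_deg T (mulop s \<circ> a) - ad_deg T (mulop s) = ereal (real_of_int (deg a))"
    if "s \<in> S" "mulop s \<circ> a \<in> B" for s
    unfolding ad_deg_B[OF that(2) mulop_comp_nonzero[OF that(1) assms(2)]]
      ad_deg_B[OF S_B[OF that(1)] mulop_S_nonzero[OF that(1)]] deg_eq[OF assms(2) that] by simp
  obtain s where s: "s \<in> S" "mulop s \<circ> a \<in> B" using assms(1) mem_loc_iff by blast
  have "a = left_frac s (mulop s \<circ> a)" using left_frac_eq_iff[OF s(1)] by simp
  then show "\<exists>s\<in>S. \<exists>b\<in>B. a = left_frac s b \<and>
      ereal (real_of_int (deg a)) = ad_deg T b - ad_deg T (mulop s)"
    using s deg[OF s] by (intro bexI[of _ s] bexI[of _ "mulop s \<circ> a"]) simp_all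
  fix d assume "\<exists>s\<in>S. \<exists>b\<in>B. a = left_frac s b \<and> d = ad_deg T b - ad_deg T (mulop s)"
  then obtain t b where t: "t \<in> S" "b \<in> B" "a = left_frac t b" "d = ad_deg T b - ad_deg T (mulop t)"
    by blast
  have "mulop t \<circ> a = b" using left_frac_eq_iff[OF t(1)] t(3) by blast
  then show "d = ereal (real_of_int (deg a))" using deg[OF t(1)] t(2,4) by simp
qed

lemma filt_deg_le:
  assumes "a \<in> filt T S B m"
  shows "a \<in> A" "deg_le a m"
  using assms loc_deg_eq by (auto simp: filt_def deg_le_def)

text \<open>A fraction equal to zero has numerator zero, of degree minus infinity. The case
  \<open>m = -1\<close> places each operator in its own coset in \<open>sigma0\<close>.\<close>

lemma zero_filt: "(\<lambda>x. 0) \<in> filt T S B m"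
proof -
  have "loc_deg T S B (\<lambda>x. 0) = - \<infinity>"
    unfolding loc_deg_def
  proof (rule the_equality)
    have ad: "ad_deg T (\<lambda>x. 0) - ad_deg T (mulop s) = - \<infinity>" if "s \<in> S" for s
      using ad_deg_B[OF S_B[OF that] mulop_S_nonzero[OF that]] by (simp add: ad_deg_def)
    have "(\<lambda>x. 0) = left_frac 1 (\<lambda>x::'a. 0)" by (simp add: left_frac_def mulop_def fun_eq_iff)
    then show "\<exists>s\<in>S. \<exists>b\<in>B. (\<lambda>x. 0) = left_frac s b \<and> - \<infinity> = ad_deg T b - ad_deg T (mulop s)"
      using ad[OF S_one] S_one B_zero by (intro bexI[of _ 1] bexI[of _ "\<lambda>x. 0"]) simp_all
    fix d assume "\<exists>s\<in>S. \<exists>b\<in>B. (\<lambda>x. 0) = left_frac s b \<and> d = ad_deg T b - ad_deg T (mulop s)"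
    then obtain t b where t: "t \<in> S" "(\<lambda>x. 0) = left_frac t b" "d = ad_deg T b - ad_deg T (mulop t)"
      by blast
    have "mulop t \<circ> (\<lambda>x::'a. 0) = b" using left_frac_eq_iff[OF t(1)] t(2) by blast
    then have "b = (\<lambda>x. 0)" by (auto simp: mulop_def)
    then show "d = - \<infinity>" using t ad by simp
  qed
  then show ?thesis using B_subset_loc[OF B_zero] by (simp add: filt_def)
qed

text \<open>\<open>L\<close> lies in its own coset, hence in that of \<open>T\<close>, which
  exhibits \<open>L - T\<close> as an element of the filtration step \<open>-1\<close>.\<close>

lemma sigma0_eq_imp_deg_le:
  assumes "sigma0 scale T S B L = sigma0 scale T S B T"
  shows "deg_le (\<lambda>x. L x - T x) (-1)"
proof -
  have coset: "sigma0 scale T S B P = {\<lambda>x. h x + P x | h. h \<in> filt T S B (-1)}" for P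
    by (auto simp: sigma0_def a_r_coset_def r_coset_def diff_ring_simps)
  have "L \<in> sigma0 scale T S B L"
    unfolding coset mem_Collect_eq by (rule exI[of _ "\<lambda>x. 0"]) (simp add: zero_filt)
  then have "L \<in> sigma0 scale T S B T" by (simp only: assms)
  then obtain h where h: "L = (\<lambda>x. h x + T x) \<and> h \<in> filt T S B (-1)"
    unfolding coset mem_Collect_eq by (rule exE)
  then have "(\<lambda>x. L x - T x) = h" by simp
  then show ?thesis using filt_deg_le(2) h by simp
qed

end

section \<open>Homomorphisms of right submodules of the localisation\<close>

context ore_setting
begin

text \<open>For a suitable \<open>t\<close> in \<open>S\<close> the operator
  \<open>b = s^-1 m t\<close> lies in \<open>B\<close>. Applying \<phi> to \<open>m t = s b\<close>
  gives \<open>\<phi>(m) t = \<phi>(s) b = \<phi>(s) s^-1 m t\<close>, and \<open>t\<close>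
  cancels.\<close>

lemma right_hom_is_left_mult:
  fixes \<phi> :: "('a \<Rightarrow> 'a) \<Rightarrow> 'a \<Rightarrow> 'a"
  assumes "M \<subseteq> A" "\<And>m b. m \<in> M \<Longrightarrow> b \<in> B \<Longrightarrow> m \<circ> b \<in> M" "s \<in> S" "mulop s \<in> M"
    and hom: "\<And>m b. m \<in> M \<Longrightarrow> b \<in> B \<Longrightarrow> \<phi> (m \<circ> b) = \<phi> m \<circ> b" and "m \<in> M"
  shows "\<phi> m = (\<phi> (mulop s) \<circ> mulop (inverse s)) \<circ> m"
proof -
  have "mulop (inverse s) \<circ> m \<in> A" using loc_comp mulop_inverse_loc assms by blast
  then obtain t where t: "t \<in> S" "(mulop (inverse s) \<circ> m) \<circ> mulop t \<in> B"
    using right_denominator by blast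
  let ?b = "(mulop (inverse s) \<circ> m) \<circ> mulop t"
  have "m \<circ> mulop t = mulop s \<circ> ?b"
    using mulop_cancel(2)[OF S_nonzero[OF assms(3)]] by (simp only: comp_assoc)
  then have "\<phi> m \<circ> mulop t = \<phi> (mulop s) \<circ> ?b"
    using hom[OF \<open>m \<in> M\<close> S_B[OF t(1)]] hom[OF assms(4) t(2)] by simp
  also have "\<dots> = ((\<phi> (mulop s) \<circ> mulop (inverse s)) \<circ> m) \<circ> mulop t" by (simp only: comp_assoc)
  finally show ?thesis by (rule iffD1[OF comp_mulop_eq_iff[OF S_nonzero[OF t(1)]]])
qed

lemma ring_B: "ring (sub_ring_on scale B)"
proof (rule ringI)
  show "abelian_group (sub_ring_on scale B)"
  proof (rule abelian_groupI)
    fix P assume "P \<in> carrier (sub_ring_on scale B)"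
    then show "\<exists>Q\<in>carrier (sub_ring_on scale B). Q \<oplus>\<^bsub>sub_ring_on scale B\<^esub> P = \<zero>\<^bsub>sub_ring_on scale B\<^esub>"
      by (intro bexI[of _ "\<lambda>x. - P x"]) (simp_all add: diff_ring_simps B_uminus)
  qed (simp_all add: diff_ring_simps B_add B_zero algebra_simps)
  show "Group.monoid (sub_ring_on scale B)"
    by (rule monoidI) (simp_all add: diff_ring_simps B_comp B_id comp_assoc)
qed (auto simp: diff_ring_simps additive.add[OF B_additive])

definition right_submodule :: "('a \<Rightarrow> 'a) set \<Rightarrow> bool" where
  "right_submodule M \<longleftrightarrow> M \<subseteq> A \<and> (\<forall>m\<in>M. \<forall>n\<in>M. (\<lambda>x. m x + n x) \<in> M) \<and> (\<lambda>x. 0) \<in> M \<and>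
    (\<forall>m\<in>M. (\<lambda>x. - m x) \<in> M) \<and> (\<forall>m\<in>M. \<forall>b\<in>B. m \<circ> b \<in> M)"

lemma right_mult_module_simps:
  "carrier (right_mult_module (sub_ring_on scale Y) M) = M"
  "m \<oplus>\<^bsub>right_mult_module (sub_ring_on scale Y) M\<^esub> n = (\<lambda>x. m x + n x)"
  "\<zero>\<^bsub>right_mult_module (sub_ring_on scale Y) M\<^esub> = (\<lambda>x. 0)"
  "b \<odot>\<^bsub>right_mult_module (sub_ring_on scale Y) M\<^esub> m = m \<circ> b"
  by (simp_all add: right_mult_module_def diff_ring_simps)

lemma regular_simps:
  "carrier (right_regular (sub_ring_on scale Y)) = Y"
  "P \<oplus>\<^bsub>right_regular (sub_ring_on scale Y)\<^esub> Q = (\<lambda>x. P x + Q x)"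
  "Q \<odot>\<^bsub>right_regular (sub_ring_on scale Y)\<^esub> P = P \<circ> Q"
  "carrier (left_regular (sub_ring_on scale Y)) = Y"
  "P \<oplus>\<^bsub>left_regular (sub_ring_on scale Y)\<^esub> Q = (\<lambda>x. P x + Q x)"
  "Q \<odot>\<^bsub>left_regular (sub_ring_on scale Y)\<^esub> P = Q \<circ> P"
  by (simp_all add: right_regular_def left_regular_def diff_ring_simps)

lemma right_module_right_submodule:
  assumes "right_submodule M"
  shows "right_module (sub_ring_on scale B) (right_mult_module (sub_ring_on scale A) M)"
proof -
  have M: "M \<subseteq> A" "\<And>m n. m \<in> M \<Longrightarrow> n \<in> M \<Longrightarrow> (\<lambda>x. m x + n x) \<in> M" "(\<lambda>x. 0) \<in> M"
    "\<And>m. m \<in> M \<Longrightarrow> (\<lambda>x. - m x) \<in> M" "\<And>m b. m \<in> M \<Longrightarrow> b \<in> B \<Longrightarrow> m \<circ> b \<in> M"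
    using assms by (simp_all add: right_submodule_def)
  have add: "m (x + y) = m x + m y" if "m \<in> M" for m x y
    using additive.add[OF loc_additive] M(1) that by blast
  have "abelian_group (right_mult_module (sub_ring_on scale A) M)"
  proof (rule abelian_groupI)
    fix P assume "P \<in> carrier (right_mult_module (sub_ring_on scale A) M)"
    then show "\<exists>Q\<in>carrier (right_mult_module (sub_ring_on scale A) M).
        Q \<oplus>\<^bsub>right_mult_module (sub_ring_on scale A) M\<^esub> P = \<zero>\<^bsub>right_mult_module (sub_ring_on scale A) M\<^esub>"
      by (intro bexI[of _ "\<lambda>x. - P x"]) (simp_all add: right_mult_module_simps M)
  qed (simp_all add: right_mult_module_simps M algebra_simps)
  then show ?thesis
    unfolding right_module_def using ring_B
    by (auto simp: right_mult_module_simps diff_ring_simps M add)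
qed

text \<open>The fractional-ideal model of the dual: \<open>left_mult M\<close> carries it onto the
  homomorphisms into \<open>B\<close> as soon as \<open>M\<close> contains some
  \<open>mulop s\<close>, see \<open>carrier_dual_of_right\<close>.\<close>

definition dual_set :: "('a \<Rightarrow> 'a) set \<Rightarrow> ('a \<Rightarrow> 'a) set" where
  "dual_set M = {a \<in> A. \<forall>m\<in>M. a \<circ> m \<in> B}"

text \<open>The restriction to \<open>M\<close> matches the convention that homomorphisms are
  \<open>undefined\<close> outside the carrier.\<close>

definition left_mult :: "('a \<Rightarrow> 'a) set \<Rightarrow> ('a \<Rightarrow> 'a) \<Rightarrow> ('a \<Rightarrow> 'a) \<Rightarrow> 'a \<Rightarrow> 'a" where
  "left_mult M a = (\<lambda>m\<in>M. a \<circ> m)"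

lemma left_mult_apply: "m \<in> M \<Longrightarrow> left_mult M a m = a \<circ> m"
  by (simp add: left_mult_def)

text \<open>The multiplier of \<phi> is \<open>\<phi>(s) s^-1\<close>, by
  \<open>right_hom_is_left_mult\<close>. The target is left general because the dual takes
  \<open>N = B\<close> and the endomorphism ring takes \<open>N = M\<close>.\<close>

lemma module_hom_set_eq_left_mult:
  assumes "right_submodule M" "s \<in> S" "mulop s \<in> M" "N \<subseteq> A"
    and N: "carrier NR = N" "\<And>P Q. P \<oplus>\<^bsub>NR\<^esub> Q = (\<lambda>x. P x + Q x)" "\<And>P b. b \<odot>\<^bsub>NR\<^esub> P = P \<circ> b"
  shows "module_hom_set (sub_ring_on scale B) (right_mult_module (sub_ring_on scale A) M) NR =
    left_mult M ` {a \<in> A. \<forall>m\<in>M. a \<circ> m \<in> N}" (is "?H = ?I")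
proof
  have M: "M \<subseteq> A" "\<And>m n. m \<in> M \<Longrightarrow> n \<in> M \<Longrightarrow> (\<lambda>x. m x + n x) \<in> M"
    "\<And>m b. m \<in> M \<Longrightarrow> b \<in> B \<Longrightarrow> m \<circ> b \<in> M"
    using assms by (simp_all add: right_submodule_def)
  show "?H \<subseteq> ?I"
  proof
    fix \<phi> assume "\<phi> \<in> ?H"
    then have \<phi>: "\<phi> \<in> M \<rightarrow>\<^sub>E N" "\<And>m b. m \<in> M \<Longrightarrow> b \<in> B \<Longrightarrow> \<phi> (m \<circ> b) = \<phi> m \<circ> b"
      by (auto simp: module_hom_set_def right_mult_module_simps diff_ring_simps N)
    let ?a = "\<phi> (mulop s) \<circ> mulop (inverse s)"
    have "\<phi> (mulop s) \<in> A" using \<phi>(1) assms(3,4) by blast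
    then have a: "?a \<in> A" using loc_comp mulop_inverse_loc[OF assms(2)] by blast
    have eq: "\<phi> m = ?a \<circ> m" if "m \<in> M" for m
      by (rule right_hom_is_left_mult[of M s \<phi>]) (fact M(1,3) assms(2,3) \<phi>(2) that)+
    then have "?a \<circ> m \<in> N" if "m \<in> M" for m
      using \<phi>(1) that by (metis PiE_mem)
    moreover have "\<phi> = left_mult M ?a"
      unfolding left_mult_def using \<phi>(1) eq by (intro extensionalityI[of _ M]) (auto simp: PiE_def)
    ultimately show "\<phi> \<in> ?I" using a by blast
  qed
  show "?I \<subseteq> ?H"
  proof
    fix \<phi> assume "\<phi> \<in> ?I"
    then obtain a where a: "a \<in> A" "\<And>m. m \<in> M \<Longrightarrow> a \<circ> m \<in> N" "\<phi> = left_mult M a" by blast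
    have "a (x + y) = a x + a y" for x y using additive.add[OF loc_additive[OF a(1)]] .
    then show "\<phi> \<in> ?H"
      unfolding module_hom_set_def a(3) using a(2) M
      by (auto simp: right_mult_module_simps diff_ring_simps N left_mult_def fun_eq_iff)
  qed
qed

lemma carrier_dual_of_right:
  assumes "right_submodule M" "s \<in> S" "mulop s \<in> M"
  shows "carrier (dual_of_right (sub_ring_on scale B) (right_mult_module (sub_ring_on scale A) M)) =
    left_mult M ` dual_set M"
  unfolding dual_of_right_def dual_set_def
  using module_hom_set_eq_left_mult[OF assms, of B "right_regular (sub_ring_on scale B)"] B_subset_loc
  by (auto simp: regular_simps)

lemma dual_set_add:
  "a \<in> dual_set M \<Longrightarrow> b \<in> dual_set M \<Longrightarrow> (\<lambda>x. a x + b x) \<in> dual_set M"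
  using B_add by (force simp: dual_set_def loc_add comp_def)

lemma dual_set_comp: "b \<in> B \<Longrightarrow> a \<in> dual_set M \<Longrightarrow> b \<circ> a \<in> dual_set M"
  using B_comp[of b] loc_comp[OF B_subset_loc] by (simp add: dual_set_def comp_assoc)

lemma dual_of_right_simps:
  assumes "a \<in> dual_set M" "a' \<in> dual_set M"
  shows "left_mult M a \<oplus>\<^bsub>dual_of_right (sub_ring_on scale B) (right_mult_module (sub_ring_on scale A) M)\<^esub>
      left_mult M a' = left_mult M (\<lambda>x. a x + a' x)"
    "b \<odot>\<^bsub>dual_of_right (sub_ring_on scale B) (right_mult_module (sub_ring_on scale A) M)\<^esub> left_mult M a =
      left_mult M (b \<circ> a)"
  by (auto simp: dual_of_right_def left_mult_def right_mult_module_simps diff_ring_simps fun_eq_iff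
      restrict_def)

text \<open>The mirror image of \<open>right_hom_is_left_mult\<close> on the dual. With
  \<open>b = t a s^-1\<close> in \<open>B\<close>, applying \<psi> to \<open>t a = b s\<close> gives
  \<open>t \<psi>(a) = b \<psi>(s)\<close>; so \<psi> is right multiplication by
  \<open>s^-1 \<psi>(s)\<close>.\<close>

lemma left_dual_hom:
  fixes \<psi> :: "(('a \<Rightarrow> 'a) \<Rightarrow> 'a \<Rightarrow> 'a) \<Rightarrow> 'a \<Rightarrow> 'a"
  assumes M: "right_submodule M" "s \<in> S" "mulop s \<in> M" "mulop s \<in> dual_set M"
    and hom: "\<And>a b. a \<in> dual_set M \<Longrightarrow> b \<in> B \<Longrightarrow> \<psi> (left_mult M (b \<circ> a)) = b \<circ> \<psi> (left_mult M a)"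
    and "a \<in> dual_set M"
  shows "\<psi> (left_mult M a) = a \<circ> (mulop (inverse s) \<circ> \<psi> (left_mult M (mulop s)))"
proof -
  have a: "a \<in> A" using assms(6) by (simp add: dual_set_def)
  obtain t where t: "t \<in> S" "mulop t \<circ> (a \<circ> mulop (inverse s)) \<in> B"
    using loc_comp[OF a mulop_inverse_loc[OF assms(2)]] mem_loc_iff by blast
  let ?b = "mulop t \<circ> (a \<circ> mulop (inverse s))"
  have "mulop t \<circ> a = ?b \<circ> mulop s"
    using mulop_cancel(4)[OF S_nonzero[OF assms(2)], of "mulop t \<circ> a"] by (simp only: comp_assoc)
  then have "mulop t \<circ> \<psi> (left_mult M a) = ?b \<circ> \<psi> (left_mult M (mulop s))"
    using hom[OF assms(6) S_B[OF t(1)]] hom[OF assms(4) t(2)] by simp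
  also have "\<dots> = mulop t \<circ> (a \<circ> (mulop (inverse s) \<circ> \<psi> (left_mult M (mulop s))))"
    by (simp only: comp_assoc)
  finally show ?thesis by (rule iffD1[OF mulop_comp_eq_iff[OF S_nonzero[OF t(1)]]])
qed

text \<open>The hypothesis \<open>closed\<close> says that the bidual, viewed inside
  \<open>A\<close>, is contained in \<open>M\<close>; with \<open>left_dual_hom\<close> this makes
  the canonical map surjective. It is injective because \<open>m\<close> is recovered from its value
  at the functional given by \<open>s\<close>.\<close>

lemma reflexive_right_submodule:
  assumes M: "right_submodule M" "s \<in> S" "mulop s \<in> M" "mulop s \<in> dual_set M"
    and closed: "\<And>c. c \<in> A \<Longrightarrow> (\<And>a. a \<in> dual_set M \<Longrightarrow> a \<circ> c \<in> B) \<Longrightarrow> c \<in> M"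
  shows "reflexive_right_module (sub_ring_on scale B) (right_mult_module (sub_ring_on scale A) M)"
proof -
  let ?B = "sub_ring_on scale B" and ?M = "right_mult_module (sub_ring_on scale A) M"
  let ?D = "dual_of_right ?B ?M"
  let ?c = "canonical_map ?B ?M"
  have Mcl: "M \<subseteq> A" "\<And>m n. m \<in> M \<Longrightarrow> n \<in> M \<Longrightarrow> (\<lambda>x. m x + n x) \<in> M"
    "\<And>m b. m \<in> M \<Longrightarrow> b \<in> B \<Longrightarrow> m \<circ> b \<in> M"
    using M by (simp_all add: right_submodule_def)
  note D = carrier_dual_of_right[OF M(1-3)]
  have c: "?c m (left_mult M a) = a \<circ> m" if "m \<in> M" "a \<in> dual_set M" for m a
    using that by (simp add: canonical_map_def D right_mult_module_simps left_mult_apply)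
  have cB: "a \<circ> m \<in> B" if "m \<in> M" "a \<in> dual_set M" for m a
    using that by (simp add: dual_set_def)
  have c_ext: "?c m \<in> extensional (left_mult M ` dual_set M)" if "m \<in> M" for m
    using that by (simp add: canonical_map_def D right_mult_module_simps)
  have dual_add: "a (x + y) = a x + a y" if "a \<in> dual_set M" for a x y
    using that additive.add[OF loc_additive] by (simp add: dual_set_def)
  \<comment> \<open>Functionals are written as \<open>left_mult M a\<close>, which turns the
    conditions on \<psi> into conditions on operators \<open>a\<close>.\<close>
  have bidual: "carrier (bidual ?B ?M) =
      {\<psi> \<in> left_mult M ` dual_set M \<rightarrow>\<^sub>E B.
        (\<forall>a\<in>dual_set M. \<forall>a'\<in>dual_set M. \<psi> (left_mult M (\<lambda>x. a x + a' x)) =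
           (\<lambda>x. \<psi> (left_mult M a) x + \<psi> (left_mult M a') x)) \<and>
        (\<forall>b\<in>B. \<forall>a\<in>dual_set M. \<psi> (left_mult M (b \<circ> a)) = b \<circ> \<psi> (left_mult M a))}"
    unfolding bidual_def dual_of_left_def
    by (simp add: module_hom_set_def D regular_simps diff_ring_simps dual_of_right_simps)
  have mem: "?c m \<in> carrier (bidual ?B ?M)" if "m \<in> M" for m
    unfolding bidual using that c_ext[OF that] dual_set_add dual_set_comp
    by (simp add: c cB PiE_def comp_assoc) (auto simp: c cB fun_eq_iff)
  have hom: "?c \<in> module_hom_set ?B ?M (bidual ?B ?M)"
  proof -
    have "?c \<in> M \<rightarrow>\<^sub>E carrier (bidual ?B ?M)"
      using mem by (auto simp: canonical_map_def right_mult_module_simps)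
    moreover have "?c (\<lambda>x. m x + n x) = ?c m \<oplus>\<^bsub>bidual ?B ?M\<^esub> ?c n" if "m \<in> M" "n \<in> M" for m n
    proof (rule extensionalityI[OF c_ext[OF Mcl(2)[OF that]]])
      show "?c m \<oplus>\<^bsub>bidual ?B ?M\<^esub> ?c n \<in> extensional (left_mult M ` dual_set M)"
        by (simp add: bidual_def dual_of_left_def D)
    next
      fix \<phi> assume "\<phi> \<in> left_mult M ` dual_set M"
      then obtain a where "a \<in> dual_set M" "\<phi> = left_mult M a" by blast
      then show "?c (\<lambda>x. m x + n x) \<phi> = (?c m \<oplus>\<^bsub>bidual ?B ?M\<^esub> ?c n) \<phi>"
        using that Mcl(2)[OF that] dual_add
        by (simp add: bidual_def dual_of_left_def D c diff_ring_simps) (simp add: fun_eq_iff)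
    qed
    moreover have "?c (m \<circ> b) = b \<odot>\<^bsub>bidual ?B ?M\<^esub> ?c m" if "m \<in> M" "b \<in> B" for m b
    proof (rule extensionalityI[OF c_ext[OF Mcl(3)[OF that]]])
      show "b \<odot>\<^bsub>bidual ?B ?M\<^esub> ?c m \<in> extensional (left_mult M ` dual_set M)"
        by (simp add: bidual_def dual_of_left_def D)
    next
      fix \<phi> assume "\<phi> \<in> left_mult M ` dual_set M"
      then obtain a where "a \<in> dual_set M" "\<phi> = left_mult M a" by blast
      then show "?c (m \<circ> b) \<phi> = (b \<odot>\<^bsub>bidual ?B ?M\<^esub> ?c m) \<phi>"
        using that Mcl(3)[OF that]
        by (simp add: bidual_def dual_of_left_def D c diff_ring_simps comp_assoc)
    qed
    ultimately show ?thesis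
      by (simp add: module_hom_set_def right_mult_module_simps diff_ring_simps)
  qed
  have "inj_on ?c M"
  proof (rule inj_onI)
    fix m n assume mn: "m \<in> M" "n \<in> M" "?c m = ?c n"
    then have "mulop s \<circ> m = mulop s \<circ> n" using c[OF _ M(4)] by metis
    then show "m = n" by (rule iffD1[OF mulop_comp_eq_iff[OF S_nonzero[OF M(2)]]])
  qed
  moreover have "\<psi> \<in> ?c ` M" if "\<psi> \<in> carrier (bidual ?B ?M)" for \<psi>
  proof -
    have \<psi>: "\<psi> \<in> left_mult M ` dual_set M \<rightarrow>\<^sub>E B"
      "\<And>a b. a \<in> dual_set M \<Longrightarrow> b \<in> B \<Longrightarrow> \<psi> (left_mult M (b \<circ> a)) = b \<circ> \<psi> (left_mult M a)"
      using that unfolding bidual by blast+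
    \<comment> \<open>The right multiplier from \<open>left_dual_hom\<close> is the preimage of
      \<psi>.\<close>
    let ?m = "mulop (inverse s) \<circ> \<psi> (left_mult M (mulop s))"
    have eq: "\<psi> (left_mult M a) = a \<circ> ?m" if "a \<in> dual_set M" for a
      using left_dual_hom[OF M \<psi>(2) that] by blast
    have \<psi>B: "\<psi> (left_mult M a) \<in> B" if "a \<in> dual_set M" for a
      using \<psi>(1) that by blast
    have "?m \<in> A" using loc_comp mulop_inverse_loc[OF M(2)] B_subset_loc[OF \<psi>B[OF M(4)]] by blast
    then have m: "?m \<in> M" using closed eq \<psi>B by metis
    have "\<psi> = ?c ?m"
    proof (rule extensionalityI[OF _ c_ext[OF m]])
      show "\<psi> \<in> extensional (left_mult M ` dual_set M)" using \<psi>(1) by (simp add: PiE_def)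
    next
      fix \<phi> assume "\<phi> \<in> left_mult M ` dual_set M"
      then show "\<psi> \<phi> = ?c ?m \<phi>" using eq c[OF m] by force
    qed
    then show ?thesis using m by blast
  qed
  ultimately have "bij_betw ?c (carrier ?M) (carrier (bidual ?B ?M))"
    using mem by (auto simp: bij_betw_def right_mult_module_simps)
  then show ?thesis
    unfolding reflexive_right_module_def using hom right_module_right_submodule[OF M(1)] by blast
qed

text \<open>Composing multipliers composes the maps. Surjectivity is
  \<open>module_hom_set_eq_left_mult\<close> with target \<open>M\<close>, and a multiplier is
  recovered from its value at the invertible \<open>s\<close>.\<close>

lemma End_ring_iso:
  assumes M: "right_submodule M" "s \<in> S" "mulop s \<in> M"
    and E: "E = {a \<in> A. \<forall>m\<in>M. a \<circ> m \<in> M}"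
  shows "left_mult M \<in> ring_iso (sub_ring_on scale E)
    (End_ring (sub_ring_on scale B) (right_mult_module (sub_ring_on scale A) M))"
proof -
  let ?B = "sub_ring_on scale B" and ?M = "right_mult_module (sub_ring_on scale A) M"
  have MA: "M \<subseteq> A" using M by (simp add: right_submodule_def)
  have car: "carrier (End_ring ?B ?M) = left_mult M ` E"
    using module_hom_set_eq_left_mult[OF M MA, of ?M]
    by (simp add: End_ring_def right_mult_module_simps E)
  have "inj_on (left_mult M) E"
  proof (rule inj_onI)
    fix a b assume "left_mult M a = left_mult M b"
    then have "a \<circ> mulop s = b \<circ> mulop s" using left_mult_apply[OF M(3)] by metis
    then show "a = b" by (rule iffD1[OF comp_mulop_eq_iff[OF S_nonzero[OF M(2)]]])
  qed
  then have "bij_betw (left_mult M) (carrier (sub_ring_on scale E)) (carrier (End_ring ?B ?M))"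
    by (simp add: bij_betw_def car diff_ring_simps)
  moreover have "left_mult M \<in> ring_hom (sub_ring_on scale E) (End_ring ?B ?M)"
  proof (rule ring_hom_memI)
    fix a assume "a \<in> carrier (sub_ring_on scale E)"
    then show "left_mult M a \<in> carrier (End_ring ?B ?M)" by (simp add: car diff_ring_simps)
  next
    fix a b assume "a \<in> carrier (sub_ring_on scale E)" "b \<in> carrier (sub_ring_on scale E)"
    then have "\<And>m. m \<in> M \<Longrightarrow> b \<circ> m \<in> M" by (simp add: diff_ring_simps E)
    then show "left_mult M (a \<otimes>\<^bsub>sub_ring_on scale E\<^esub> b) =
        left_mult M a \<otimes>\<^bsub>End_ring ?B ?M\<^esub> left_mult M b"
      by (auto simp: diff_ring_simps End_ring_def right_mult_module_simps left_mult_def compose_def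
          comp_assoc fun_eq_iff)
    show "left_mult M (a \<oplus>\<^bsub>sub_ring_on scale E\<^esub> b) =
        left_mult M a \<oplus>\<^bsub>End_ring ?B ?M\<^esub> left_mult M b"
      by (auto simp: diff_ring_simps End_ring_def right_mult_module_simps left_mult_def
          restrict_def fun_eq_iff)
  next
    show "left_mult M \<one>\<^bsub>sub_ring_on scale E\<^esub> = \<one>\<^bsub>End_ring ?B ?M\<^esub>"
      by (auto simp: diff_ring_simps End_ring_def right_mult_module_simps left_mult_def)
  qed
  ultimately show ?thesis by (simp add: ring_iso_def)
qed

section \<open>The embedding into the quotient skew-field\<close>

lemma quotient_skew_field_simps:
  assumes "quotient_skew_field (sub_ring_on scale B) Q \<iota>"
  shows "ring Q" "P \<in> B \<Longrightarrow> \<iota> P \<in> carrier Q"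
    "P \<in> B \<Longrightarrow> P' \<in> B \<Longrightarrow> \<iota> (P \<circ> P') = \<iota> P \<otimes>\<^bsub>Q\<^esub> \<iota> P'"
    "P \<in> B \<Longrightarrow> P' \<in> B \<Longrightarrow> \<iota> (\<lambda>x. P x + P' x) = \<iota> P \<oplus>\<^bsub>Q\<^esub> \<iota> P'"
    "\<iota> id = \<one>\<^bsub>Q\<^esub>" "\<iota> (\<lambda>x. 0) = \<zero>\<^bsub>Q\<^esub>"
    "s \<in> S \<Longrightarrow> \<iota> (mulop s) \<in> Units Q"
proof -
  have hom: "\<iota> \<in> ring_hom (sub_ring_on scale B) Q" and inj: "inj_on \<iota> B"
    and units: "Units Q = carrier Q - {\<zero>\<^bsub>Q\<^esub>}"
    using assms by (simp_all add: quotient_skew_field_def)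
  show ring: "ring Q" using assms by (simp add: quotient_skew_field_def)
  show carr: "\<iota> P \<in> carrier Q" if "P \<in> B" for P using ring_hom_closed[OF hom] that by simp
  show "\<iota> (P \<circ> P') = \<iota> P \<otimes>\<^bsub>Q\<^esub> \<iota> P'" if "P \<in> B" "P' \<in> B"
    using ring_hom_mult[OF hom, of P P'] that by (simp add: diff_ring_simps)
  show "\<iota> (\<lambda>x. P x + P' x) = \<iota> P \<oplus>\<^bsub>Q\<^esub> \<iota> P'" if "P \<in> B" "P' \<in> B"
    using ring_hom_add[OF hom, of P P'] that by (simp add: diff_ring_simps)
  show "\<iota> id = \<one>\<^bsub>Q\<^esub>" using ring_hom_one[OF hom] by (simp add: diff_ring_simps)
  show zero: "\<iota> (\<lambda>x. 0) = \<zero>\<^bsub>Q\<^esub>"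
    using ring_hom_zero[OF hom ring_B ring] by (simp add: diff_ring_simps)
  show "\<iota> (mulop s) \<in> Units Q" if "s \<in> S"
    unfolding units using carr[OF S_B[OF that]] inj_onD[OF inj _ S_B[OF that] B_zero]
      S_nonzero[OF that] mulop_zero_iff[of s] zero by auto
qed

text \<open>Makes the \<open>THE\<close> in \<open>loc_embed\<close> computable from any denominator
  that clears \<open>a\<close>.\<close>

lemma loc_embed_eq:
  assumes Q: "quotient_skew_field (sub_ring_on scale B) Q \<iota>" and "s \<in> S" "mulop s \<circ> a \<in> B"
  shows "loc_embed S B Q \<iota> a = inv\<^bsub>Q\<^esub> (\<iota> (mulop s)) \<otimes>\<^bsub>Q\<^esub> \<iota> (mulop s \<circ> a)"
  unfolding loc_embed_def
proof (rule the_equality)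
  show "\<exists>t\<in>S. \<exists>b\<in>B. a = left_frac t b \<and>
      inv\<^bsub>Q\<^esub> (\<iota> (mulop s)) \<otimes>\<^bsub>Q\<^esub> \<iota> (mulop s \<circ> a) = inv\<^bsub>Q\<^esub> (\<iota> (mulop t)) \<otimes>\<^bsub>Q\<^esub> \<iota> b"
    using assms(2,3) left_frac_eq_iff[of s a "mulop s \<circ> a"] by blast
next
  note \<iota> = quotient_skew_field_simps[OF Q]
  interpret Q: ring Q by (rule \<iota>(1))
  fix q assume "\<exists>t\<in>S. \<exists>b\<in>B. a = left_frac t b \<and> q = inv\<^bsub>Q\<^esub> (\<iota> (mulop t)) \<otimes>\<^bsub>Q\<^esub> \<iota> b"
  then obtain t b where tb: "t \<in> S" "b \<in> B" "a = left_frac t b"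
      "q = inv\<^bsub>Q\<^esub> (\<iota> (mulop t)) \<otimes>\<^bsub>Q\<^esub> \<iota> b" by blast
  let ?\<sigma> = "\<iota> (mulop s)" and ?\<tau> = "\<iota> (mulop t)" and ?\<gamma> = "\<iota> (mulop s \<circ> a)"
  have b: "mulop t \<circ> a = b" using left_frac_eq_iff[OF tb(1)] tb(3) by blast
  have comm: "mulop t \<circ> (mulop s \<circ> a) = mulop s \<circ> b" "mulop s \<circ> mulop t = mulop t \<circ> mulop s"
    unfolding b[symmetric] by (simp_all add: mulop_def fun_eq_iff mult.left_commute)
  have carr: "?\<sigma> \<in> carrier Q" "?\<tau> \<in> carrier Q" "?\<gamma> \<in> carrier Q" "\<iota> b \<in> carrier Q"
    using \<iota>(2) S_B assms(2,3) tb(1,2) by blast+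
  have units: "?\<sigma> \<in> Units Q" "?\<tau> \<in> Units Q" using \<iota>(7) assms(2) tb(1) by blast+
  have \<tau>\<gamma>: "?\<tau> \<otimes>\<^bsub>Q\<^esub> ?\<gamma> = ?\<sigma> \<otimes>\<^bsub>Q\<^esub> \<iota> b"
    using \<iota>(3)[OF S_B[OF tb(1)] assms(3)] \<iota>(3)[OF S_B[OF assms(2)] tb(2)] comm(1) by simp
  have \<sigma>\<tau>: "?\<sigma> \<otimes>\<^bsub>Q\<^esub> ?\<tau> = ?\<tau> \<otimes>\<^bsub>Q\<^esub> ?\<sigma>"
    using \<iota>(3)[OF S_B[OF tb(1)] S_B[OF assms(2)]] \<iota>(3)[OF S_B[OF assms(2)] S_B[OF tb(1)]] comm(2) by simp
  have qc: "q \<in> carrier Q" unfolding tb(4) using units carr by simp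
  \<comment> \<open>As \<sigma> and \<tau> commute,
    \<open>\<tau> \<sigma> q = \<sigma> \<iota>(b) = \<tau> \<gamma>\<close>; first \<tau> and then
    \<sigma> is removed.\<close>
  have "?\<tau> \<otimes>\<^bsub>Q\<^esub> (?\<sigma> \<otimes>\<^bsub>Q\<^esub> q) = (?\<sigma> \<otimes>\<^bsub>Q\<^esub> ?\<tau>) \<otimes>\<^bsub>Q\<^esub> q"
    using carr qc by (simp add: \<sigma>\<tau> Q.m_assoc)
  also have "\<dots> = ?\<sigma> \<otimes>\<^bsub>Q\<^esub> \<iota> b"
    unfolding tb(4) using carr units by (simp add: Q.m_assoc Q.m_assoc[symmetric, of ?\<tau>])
  finally have "?\<tau> \<otimes>\<^bsub>Q\<^esub> (?\<sigma> \<otimes>\<^bsub>Q\<^esub> q) = ?\<tau> \<otimes>\<^bsub>Q\<^esub> ?\<gamma>"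
    by (simp only: \<tau>\<gamma>)
  then have "?\<sigma> \<otimes>\<^bsub>Q\<^esub> q = ?\<gamma>"
    using Q.Units_l_cancel[OF units(2) Q.m_closed[OF carr(1) qc] carr(3)] by blast
  moreover have "inv\<^bsub>Q\<^esub> ?\<sigma> \<otimes>\<^bsub>Q\<^esub> (?\<sigma> \<otimes>\<^bsub>Q\<^esub> q) = (inv\<^bsub>Q\<^esub> ?\<sigma> \<otimes>\<^bsub>Q\<^esub> ?\<sigma>) \<otimes>\<^bsub>Q\<^esub> q"
    using carr units qc by (simp only: Q.m_assoc Q.Units_inv_closed)
  ultimately show "q = inv\<^bsub>Q\<^esub> ?\<sigma> \<otimes>\<^bsub>Q\<^esub> ?\<gamma>" using units qc by simp
qed

text \<open>One denominator \<open>s\<close> clears all of \<open>M\<close>, so the embedding is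
  \<open>\<sigma>^-1 \<iota>(s m)\<close> throughout and inherits additivity and right linearity
  from \<iota>.\<close>

lemma fractional_right_ideal_loc_embed:
  assumes Q: "quotient_skew_field (sub_ring_on scale B) Q \<iota>"
    and M: "right_submodule M" "s \<in> S" "mulop s \<in> M" "mulop s \<in> dual_set M"
  shows "fractional_right_ideal (sub_ring_on scale B) Q \<iota> (loc_embed S B Q \<iota> ` M)"
proof -
  let ?j = "loc_embed S B Q \<iota>" and ?\<sigma> = "\<iota> (mulop s)"
  note \<iota> = quotient_skew_field_simps[OF Q]
  interpret Q: ring Q by (rule \<iota>(1))
  have Mcl: "M \<subseteq> A" "\<And>m n. m \<in> M \<Longrightarrow> n \<in> M \<Longrightarrow> (\<lambda>x. m x + n x) \<in> M" "(\<lambda>x. 0) \<in> M"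
    "\<And>m. m \<in> M \<Longrightarrow> (\<lambda>x. - m x) \<in> M" "\<And>m b. m \<in> M \<Longrightarrow> b \<in> B \<Longrightarrow> m \<circ> b \<in> M"
    using M(1) by (simp_all add: right_submodule_def)
  have sM: "mulop s \<circ> m \<in> B" if "m \<in> M" for m using M(4) that by (simp add: dual_set_def)
  have \<sigma>: "?\<sigma> \<in> Units Q" "inv\<^bsub>Q\<^esub> ?\<sigma> \<in> carrier Q" using \<iota>(7)[OF M(2)] by simp_all
  have j: "?j m = inv\<^bsub>Q\<^esub> ?\<sigma> \<otimes>\<^bsub>Q\<^esub> \<iota> (mulop s \<circ> m)" if "m \<in> M" for m
    using loc_embed_eq[OF Q M(2) sM[OF that]] .
  have jc: "?j m \<in> carrier Q" if "m \<in> M" for m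
    using j[OF that] \<sigma> \<iota>(2)[OF sM[OF that]] by simp
  have j_add: "?j (\<lambda>x. m x + n x) = ?j m \<oplus>\<^bsub>Q\<^esub> ?j n" if "m \<in> M" "n \<in> M" for m n
  proof -
    have "mulop s \<circ> (\<lambda>x. m x + n x) = (\<lambda>x. (mulop s \<circ> m) x + (mulop s \<circ> n) x)"
      by (simp add: mulop_def fun_eq_iff distrib_left)
    then have "\<iota> (mulop s \<circ> (\<lambda>x. m x + n x)) = \<iota> (mulop s \<circ> m) \<oplus>\<^bsub>Q\<^esub> \<iota> (mulop s \<circ> n)"
      using \<iota>(4)[OF sM[OF that(1)] sM[OF that(2)]] by (simp only:)
    then show ?thesis
      unfolding j[OF Mcl(2)[OF that]] j[OF that(1)] j[OF that(2)]
      using \<sigma> \<iota>(2)[OF sM[OF that(1)]] \<iota>(2)[OF sM[OF that(2)]] by (simp only: Q.r_distr)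
  qed
  have j_comp: "?j m \<otimes>\<^bsub>Q\<^esub> \<iota> b = ?j (m \<circ> b)" if "m \<in> M" "b \<in> B" for m b
  proof -
    have "\<iota> (mulop s \<circ> (m \<circ> b)) = \<iota> (mulop s \<circ> m) \<otimes>\<^bsub>Q\<^esub> \<iota> b"
      using \<iota>(3)[OF sM[OF that(1)] that(2)] by (simp only: comp_assoc)
    then show ?thesis
      unfolding j[OF Mcl(5)[OF that]] j[OF that(1)]
      using \<sigma> \<iota>(2)[OF sM[OF that(1)]] \<iota>(2)[OF that(2)] by (simp only: Q.m_assoc)
  qed
  have j_zero: "?j (\<lambda>x. 0) = \<zero>\<^bsub>Q\<^esub>"
  proof -
    have "mulop s \<circ> (\<lambda>x::'a. 0) = (\<lambda>x. 0)" by (simp add: mulop_def fun_eq_iff)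
    then have "\<iota> (mulop s \<circ> (\<lambda>x. 0)) = \<zero>\<^bsub>Q\<^esub>" using \<iota>(6) by (simp only:)
    then show ?thesis unfolding j[OF Mcl(3)] using \<sigma> by (simp only: Q.r_null)
  qed
  have j_minus: "\<ominus>\<^bsub>Q\<^esub> ?j m = ?j (\<lambda>x. - m x)" if "m \<in> M" for m
  proof (rule Q.minus_equality[OF _ jc[OF that] jc[OF Mcl(4)[OF that]]])
    show "?j (\<lambda>x. - m x) \<oplus>\<^bsub>Q\<^esub> ?j m = \<zero>\<^bsub>Q\<^esub>"
      unfolding j_add[OF Mcl(4)[OF that] that, symmetric] by (simp add: j_zero)
  qed
  have "additive_subgroup (?j ` M) Q"
  proof (rule additive_subgroup.intro, rule group.subgroupI[OF Q.a_group])
    show "?j ` M \<subseteq> carrier (add_monoid Q)" using jc by auto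
    show "?j ` M \<noteq> {}" using Mcl(3) by blast
    fix x assume "x \<in> ?j ` M"
    then obtain m where m: "m \<in> M" "x = ?j m" by blast
    then show "inv\<^bsub>add_monoid Q\<^esub> x \<in> ?j ` M"
      using j_minus[OF m(1)] Mcl(4)[OF m(1)] by (simp add: a_inv_def)
    fix y assume "y \<in> ?j ` M"
    then obtain n where n: "n \<in> M" "y = ?j n" by blast
    show "x \<otimes>\<^bsub>add_monoid Q\<^esub> y \<in> ?j ` M"
      using j_add[OF m(1) n(1)] Mcl(2)[OF m(1) n(1)] m(2) n(2) by (metis image_eqI monoid.select_convs(1))
  qed
  moreover have "\<forall>n\<in>?j ` M. \<forall>b\<in>B. n \<otimes>\<^bsub>Q\<^esub> \<iota> b \<in> ?j ` M"
    using j_comp Mcl(5) by auto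
  \<comment> \<open>The bounds are \<open>p = \<sigma>\<close>, the image of \<open>mulop s\<close>
    in \<open>M\<close>, and \<open>q = \<sigma>^-1\<close>, because \<open>s\<close> clears
    \<open>M\<close>.\<close>
  moreover have "(\<lambda>b. ?\<sigma> \<otimes>\<^bsub>Q\<^esub> \<iota> b) ` B \<subseteq> ?j ` M"
  proof -
    have "?\<sigma> = ?j (mulop s)"
      using loc_embed_eq[OF Q S_one, of "mulop s"] S_B[OF M(2)] \<iota>(2)[OF S_B[OF M(2)]] \<iota>(5)
      by (simp add: mulop_one)
    then show ?thesis using j_comp[OF M(3)] Mcl(5)[OF M(3)] by auto
  qed
  moreover have "?j ` M \<subseteq> (\<lambda>b. inv\<^bsub>Q\<^esub> ?\<sigma> \<otimes>\<^bsub>Q\<^esub> \<iota> b) ` B"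
    using j sM by blast
  moreover have "?\<sigma> \<in> carrier Q - {\<zero>\<^bsub>Q\<^esub>}" "inv\<^bsub>Q\<^esub> ?\<sigma> \<in> carrier Q - {\<zero>\<^bsub>Q\<^esub>}"
    using \<sigma>(1) Q.Units_inv_Units[OF \<sigma>(1)] Q unfolding quotient_skew_field_def by blast+
  ultimately show ?thesis
    unfolding fractional_right_ideal_def by auto
qed

end

section \<open>Maximal admissible subspaces\<close>

lemma mem_transporter: "a \<in> transporter A V W \<longleftrightarrow> a \<in> A \<and> (\<forall>v\<in>V. a v \<in> W)"
  by (auto simp: transporter_def)

text \<open>\<open>s_U0\<close> and \<open>s_U\<close> are condition (1b) elementwise, with
  denominators cleared and one fixed \<open>s\<close>; \<open>L_deg\<close> is the form in which
  condition (2) enters.\<close>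

locale maximal_setting = degree_setting scale S B T
  for scale :: "'k::field \<Rightarrow> 'a::field \<Rightarrow> 'a" and S B T +
  fixes U0 U :: "'a set" and L :: "'a \<Rightarrow> 'a" and s :: 'a
  assumes B_eq: "B = transporter A U0 U0"
    and U0_subspace: "vs.subspace U0" and U_subspace: "vs.subspace U"
    and s_S: "s \<in> S" and s_U0: "x \<in> U0 \<Longrightarrow> s * x \<in> U" and s_U: "x \<in> U \<Longrightarrow> s * x \<in> U0"
    and L_loc: "L \<in> A" and L_U: "x \<in> U \<Longrightarrow> L x \<in> U"
    and L_deg: "deg_le (\<lambda>x. L x - T x) (-1)"
    and maximal: "admissible scale S U0 L V \<Longrightarrow> V \<subseteq> U"
begin

abbreviation M :: "('a \<Rightarrow> 'a) set" where
  "M \<equiv> transporter A U0 U"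

abbreviation D :: "('a \<Rightarrow> 'a) set" where
  "D \<equiv> transporter A U U"

lemma mem_B: "b \<in> B \<longleftrightarrow> b \<in> A \<and> (\<forall>x\<in>U0. b x \<in> U0)"
  using B_eq mem_transporter[of b A U0 U0] by simp

lemma S_U0: "t \<in> S \<Longrightarrow> x \<in> U0 \<Longrightarrow> t * x \<in> U0"
  using S_B mem_B by (fastforce simp: mulop_def)

lemma loc_apply_add: "a \<in> A \<Longrightarrow> a (x + y) = a x + a y"
  using additive.add[OF loc_additive] .

lemma loc_apply_zero: "a \<in> A \<Longrightarrow> a 0 = 0"
  using additive.zero[OF loc_additive] .

lemma loc_apply_scale: "a \<in> A \<Longrightarrow> a (scale c x) = scale c (a x)"
  using loc_linear unfolding Vector_Spaces.linear_iff by blast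

lemma loc_vimage_subspace:
  assumes "a \<in> A" "vs.subspace V"
  shows "vs.subspace {x. a x \<in> V}"
  using assms(2)
  unfolding vs.subspace_def
  by (simp add: loc_apply_add[OF assms(1)] loc_apply_zero[OF assms(1)] loc_apply_scale[OF assms(1)])

lemma S_loc: "t \<in> S \<Longrightarrow> mulop t \<in> A"
  using S_B B_subset_loc by blast

text \<open>The preimage of a subspace under an operator of \<open>A\<close> is a subspace, so
  stability under \<open>L\<close> and the upper bound pass from the set \<open>Y\<close> to its
  span, which is then admissible.\<close>

lemma span_subset_maximal:
  assumes "t \<in> S" "\<And>x. x \<in> Y \<Longrightarrow> L x \<in> Y" "\<And>x. x \<in> U0 \<Longrightarrow> t * x \<in> Y"
    and "\<And>x. x \<in> Y \<Longrightarrow> t * x \<in> U0"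
  shows "Y \<subseteq> U"
proof -
  have "vs.span Y \<subseteq> {x. L x \<in> vs.span Y}"
    using assms(2) by (intro vs.span_minimal loc_vimage_subspace L_loc) (auto intro: vs.span_base)
  then have "L ` vs.span Y \<subseteq> vs.span Y" by blast
  moreover have "mulop t ` U0 \<subseteq> vs.span Y"
    using assms(3) by (auto simp: mulop_def intro: vs.span_base)
  moreover have "vs.span Y \<subseteq> mulop (inverse t) ` U0"
  proof -
    have "vs.span Y \<subseteq> {x. mulop t x \<in> U0}"
      using assms(4) by (intro vs.span_minimal loc_vimage_subspace S_loc U0_subspace assms(1))
        (auto simp: mulop_def)
    moreover have "x = mulop (inverse t) (mulop t x)" for x
      using S_nonzero[OF assms(1)] by (simp add: mulop_def mult.assoc[symmetric])
    ultimately show ?thesis by blast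
  qed
  ultimately have "admissible scale S U0 L (vs.span Y)"
    unfolding admissible_def using assms(1) by blast
  then show ?thesis using maximal vs.span_superset[of Y] by blast
qed

lemma right_submodule_M: "right_submodule M"
  unfolding right_submodule_def
  using U_subspace mem_B
  by (auto simp: mem_transporter loc_add loc_uminus loc_comp B_subset_loc B_zero
      vs.subspace_add vs.subspace_neg vs.subspace_0)

lemma M_diff: "m \<in> M \<Longrightarrow> n \<in> M \<Longrightarrow> (\<lambda>x. m x - n x) \<in> M"
  using loc_add[of m "\<lambda>x. - n x"] loc_uminus U_subspace
  by (simp add: mem_transporter vs.subspace_diff)

lemma s_M: "mulop s \<in> M"
  using S_loc[OF s_S] s_U0 by (simp add: mem_transporter mulop_def)

lemma s_dual: "mulop s \<in> dual_set M"
  using S_loc[OF s_S] s_U by (simp add: dual_set_def mem_transporter mem_B loc_comp mulop_def)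

lemma bidual_subset_M:
  assumes "c \<in> A" "\<And>a. a \<in> dual_set M \<Longrightarrow> a \<circ> c \<in> B"
  shows "c \<in> M"
proof -
  \<comment> \<open>\<open>N\<close> is the bidual of \<open>M\<close>, viewed inside
    \<open>A\<close>.\<close>
  define N where "N = {c \<in> A. \<forall>a\<in>dual_set M. a \<circ> c \<in> B}"
  have LN: "L \<circ> n \<in> N" if "n \<in> N" for n
  proof -
    have "a \<circ> (L \<circ> n) \<in> B" if a: "a \<in> dual_set M" for a
    proof -
      \<comment> \<open>Since \<open>L\<close> maps \<open>M\<close> into itself, composing with
        \<open>L\<close> on the right preserves the dual; this moves \<open>L\<close> from
        \<open>n\<close> over to \<open>a\<close>.\<close>
      have "L \<circ> m \<in> M" if "m \<in> M" for m
        using that L_loc L_U loc_comp by (simp add: mem_transporter)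
      then have "a \<circ> L \<in> dual_set M"
        using a L_loc loc_comp by (simp add: dual_set_def comp_assoc)
      then show ?thesis using \<open>n \<in> N\<close> by (simp add: N_def comp_assoc[symmetric])
    qed
    then show ?thesis using that L_loc loc_comp by (simp add: N_def)
  qed
  let ?Y = "{n x | n x. n \<in> N \<and> x \<in> U0}"
  have "?Y \<subseteq> U"
  proof (rule span_subset_maximal[OF s_S])
    show "L y \<in> ?Y" if "y \<in> ?Y" for y
    proof -
      obtain n x where "n \<in> N" "x \<in> U0" "y = n x" using \<open>y \<in> ?Y\<close> by blast
      then have "L \<circ> n \<in> N" "x \<in> U0" "L y = (L \<circ> n) x" using LN by simp_all
      then show ?thesis by blast
    qed
    \<comment> \<open>Membership of \<open>mulop s\<close> in \<open>M\<close> gives the lower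
      bound, membership in the dual the upper bound.\<close>
    have "mulop s \<in> N"
      using S_loc[OF s_S] s_M by (simp add: N_def dual_set_def)
    then show "s * x \<in> ?Y" if "x \<in> U0" for x using that by (auto simp: mulop_def)
    show "s * y \<in> U0" if "y \<in> ?Y" for y
    proof -
      obtain n x where nx: "n \<in> N" "x \<in> U0" "y = n x" using \<open>y \<in> ?Y\<close> by blast
      then have "mulop s \<circ> n \<in> B" using s_dual by (simp add: N_def)
      then show ?thesis using mem_B nx by (fastforce simp: mulop_def)
    qed
  qed
  then show ?thesis using assms by (auto simp: N_def mem_transporter)
qed

lemma End_M_eq_D: "{a \<in> A. \<forall>m\<in>M. a \<circ> m \<in> M} = D"
proof
  show "D \<subseteq> {a \<in> A. \<forall>m\<in>M. a \<circ> m \<in> M}" by (auto simp: mem_transporter loc_comp)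
  show "{a \<in> A. \<forall>m\<in>M. a \<circ> m \<in> M} \<subseteq> D"
  proof
    fix a assume "a \<in> {a \<in> A. \<forall>m\<in>M. a \<circ> m \<in> M}"
    then have a: "a \<in> A" "\<And>m. m \<in> M \<Longrightarrow> a \<circ> m \<in> M" by auto
    let ?ad = "\<lambda>j. (commutator L ^^ j) a"
    have adA: "?ad j \<in> A" for j using loc_ad L_loc a(1) by blast
    \<comment> \<open>Brackets with \<open>L\<close> remain endomorphisms of \<open>M\<close>, since
      \<open>L\<close> itself is one.\<close>
    have adM: "?ad j \<circ> m \<in> M" if "m \<in> M" for j m
      using that
    proof (induct j arbitrary: m)
      case 0
      then show ?case using a(2) by (simp only: funpow_0)
    next
      case (Suc j)
      have LM: "L \<circ> n \<in> M" if "n \<in> M" for n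
        using that L_loc L_U loc_comp by (simp add: mem_transporter)
      have "L \<circ> (?ad j \<circ> m) \<in> M" "?ad j \<circ> (L \<circ> m) \<in> M" using Suc LM by blast+
      moreover have "?ad (Suc j) \<circ> m = (\<lambda>x. (L \<circ> (?ad j \<circ> m)) x - (?ad j \<circ> (L \<circ> m)) x)"
        by (simp add: fun_eq_iff) (simp add: commutator_def)
      ultimately show ?case using M_diff by (simp only:)
    qed
    \<comment> \<open>As \<open>s\<close> lies in \<open>M\<close> and in the dual, it sandwiches
      every endomorphism into \<open>B\<close>.\<close>
    have "mulop s \<circ> ?ad j \<circ> mulop s \<in> B" for j
      using adM[OF s_M, of j] s_dual by (simp add: dual_set_def comp_assoc)
    then obtain N where N: "?ad N = (\<lambda>x. 0)"
      using ad_eventually_zero[OF L_loc L_deg a(1) s_S] by blast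
    \<comment> \<open>Elements of \<open>B\<close> are controlled on \<open>U0\<close>, not on
      \<open>U\<close>. The factor \<open>s^-1\<close> is inserted so that the cleared operator can
      be evaluated at \<open>s * x\<close>, which lies in \<open>U0\<close> for \<open>x\<close> in
      \<open>U\<close>.\<close>
    let ?F = "(\<lambda>j. ?ad j \<circ> mulop (inverse s)) ` {..<N}"
    have "?F \<subseteq> A" using loc_comp[OF adA mulop_inverse_loc[OF s_S]] by blast
    then obtain t where t: "t \<in> S" "\<And>b. b \<in> ?F \<Longrightarrow> mulop t \<circ> b \<in> B"
      using common_denominator[of ?F] by blast
    have ad_U: "t * ?ad j x \<in> U0" if "x \<in> U" for j x
    proof (cases "j < N")
      case True
      then have "mulop t \<circ> (?ad j \<circ> mulop (inverse s)) \<in> B" using t(2) by blast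
      then have "(mulop t \<circ> (?ad j \<circ> mulop (inverse s))) (s * x) \<in> U0"
        using mem_B s_U[OF that] by blast
      moreover have "inverse s * (s * x) = x"
        using S_nonzero[OF s_S] by (simp add: mult.assoc[symmetric])
      ultimately show ?thesis by (simp add: mulop_def)
    next
      case False
      then have "?ad j = (\<lambda>x. 0)" using ad_zero_mono[OF loc_additive[OF L_loc] N] by simp
      then show ?thesis using vs.subspace_0[OF U0_subspace] by simp
    qed
    \<comment> \<open>All \<open>j\<close> are allowed, so that passing from \<open>j\<close> to
      \<open>Suc j\<close> stays inside; only finitely many terms are nonzero.\<close>
    define W where "W = U \<union> {?ad j x | j x. x \<in> U}"
    define W' where "W' = vs.span W"
    have W: "U \<subseteq> W'" "\<And>j x. x \<in> U \<Longrightarrow> ?ad j x \<in> W'"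
      unfolding W'_def W_def by (auto intro: vs.span_base)
    have "W' \<subseteq> U"
    \<comment> \<open>In the denominator \<open>s * t\<close>, \<open>t\<close> clears the iterated
      brackets and \<open>s\<close> clears \<open>U\<close>, while each of them preserves
      \<open>U0\<close>.\<close>
    proof (rule span_subset_maximal[OF S_mult[OF s_S t(1)]])
      have "L x \<in> W'" if "x \<in> W" for x
        using that unfolding W_def
      proof
        assume "x \<in> {?ad j x | j x. x \<in> U}"
        then obtain j y where y: "y \<in> U" "x = ?ad j y" by blast
        have "L x = ?ad (Suc j) y + ?ad j (L y)" by (simp add: commutator_def y)
        then show ?thesis using W(2)[OF y(1)] W(2)[OF L_U[OF y(1)]] vs.span_add
          unfolding W'_def by metis
      qed (use L_U W in blast)
      then have "W' \<subseteq> {x. L x \<in> W'}"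
        unfolding W'_def by (intro vs.span_minimal loc_vimage_subspace L_loc) auto
      then show "L x \<in> W'" if "x \<in> W'" for x using that by blast
      show "s * t * x \<in> W'" if "x \<in> U0" for x
        using W(1) s_U0[OF S_U0[OF t(1) that]] by (auto simp: mult.assoc)
      have "s * t * x \<in> U0" if "x \<in> U" for x
        using S_U0[OF t(1) s_U[OF that]] by (simp add: ac_simps)
      moreover have "s * t * ?ad j x \<in> U0" if "x \<in> U" for j x
        using S_U0[OF s_S ad_U[OF that]] by (simp add: ac_simps)
      ultimately have "W \<subseteq> {x. mulop (s * t) x \<in> U0}"
        unfolding W_def mulop_def by blast
      then have "W' \<subseteq> {x. mulop (s * t) x \<in> U0}"
        unfolding W'_def
        by (intro vs.span_minimal loc_vimage_subspace S_loc S_mult s_S t(1) U0_subspace)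
      then show "s * t * x \<in> U0" if "x \<in> W'" for x using that by (auto simp: mulop_def)
    qed
    \<comment> \<open>The index \<open>0\<close> recovers \<open>a\<close> itself.\<close>
    then show "a \<in> D" using W(2)[of _ 0] a(1) by (auto simp: mem_transporter)
  qed
qed

end

section \<open>From the hypotheses of the theorem to the locales\<close>

lemma ring_of_type_algebra_simps:
  "carrier (ring_of_type_algebra :: 'a::field ring) = UNIV"
  "x \<oplus>\<^bsub>(ring_of_type_algebra :: 'a ring)\<^esub> y = x + y"
  "x \<otimes>\<^bsub>(ring_of_type_algebra :: 'a ring)\<^esub> y = x * y"
  "\<zero>\<^bsub>(ring_of_type_algebra :: 'a ring)\<^esub> = 0"
  "\<one>\<^bsub>(ring_of_type_algebra :: 'a ring)\<^esub> = 1"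
  by (simp_all add: ring_of_type_algebra_def)

text \<open>The type class puts characteristic zero on the ground field;
  \<open>scale (of_nat n) 1 = of_nat n\<close> transports it to \<K>.\<close>

lemma k_algebra_char_0:
  fixes scale :: "'k::field_char_0 \<Rightarrow> 'a::field \<Rightarrow> 'a"
  assumes "vector_space scale" "i > 0"
  shows "of_nat i \<noteq> (0::'a)"
proof -
  interpret vector_space scale by fact
  have "scale (of_nat n) 1 = of_nat n" for n
    by (induct n) (simp_all add: scale_left_distrib)
  then show ?thesis using assms(2) scale_eq_0_iff[of "of_nat i" 1] by (metis of_nat_eq_0_iff not_gr_zero zero_neq_one)
qed

lemma subring_diff_ring:
  assumes "subring B (diff_ring scale)"
  shows "id \<in> B" "P \<in> B \<Longrightarrow> Q \<in> B \<Longrightarrow> P \<circ> Q \<in> B"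
    "P \<in> B \<Longrightarrow> Q \<in> B \<Longrightarrow> (\<lambda>x. P x + Q x) \<in> B" "P \<in> B \<Longrightarrow> \<exists>n. P \<in> diff_ops scale n"
proof -
  interpret subring B "diff_ring scale" by fact
  show "id \<in> B" using one_closed by (simp add: diff_ring_def)
  show "P \<circ> Q \<in> B" if "P \<in> B" "Q \<in> B"
    using submonoid.m_closed[OF submonoid_axioms that] by (simp add: diff_ring_def)
  show "(\<lambda>x. P x + Q x) \<in> B" if "P \<in> B" "Q \<in> B"
    using subgroup.m_closed[OF subgroup_axioms that] by (simp add: diff_ring_def)
  show "\<exists>n. P \<in> diff_ops scale n" if "P \<in> B"
    using subsetD[OF submonoid.subset[OF submonoid_axioms] that] by (simp add: diff_ring_def)
qed

text \<open>Each \<open>P\<close> in \<open>B\<close> has some finite order \<open>n\<close>, and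
  \<open>s ^ Suc n\<close> is the witness for both Ore conditions.\<close>

lemma condition_A_ore_setting:
  fixes scale :: "'k::field_char_0 \<Rightarrow> 'a::field \<Rightarrow> 'a"
  assumes "k_algebra scale" "condition_A scale R B"
    and "S \<subseteq> R" "0 \<notin> S" "1 \<in> S" "\<forall>s\<in>S. \<forall>t\<in>S. s * t \<in> S"
  shows "ore_setting scale S B"
proof -
  have vs: "vector_space scale" and scale_mult: "\<And>c x y. scale c (x * y) = scale c x * y"
    using assms(1) by (auto simp: k_algebra_def)
  have B: "subring B (diff_ring scale)" and B_scale: "\<And>c P. P \<in> B \<Longrightarrow> op_scale scale c P \<in> B"
    and R_B: "mulop ` R \<subseteq> B"
    using assms(2) by (simp_all add: condition_A_def)
  note cl = subring_diff_ring[OF B]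
  have minus: "op_scale scale (-1) P = (\<lambda>x. - P x)" for P
  proof -
    interpret vector_space scale by (rule vs)
    show ?thesis by (simp add: op_scale_def)
  qed
  have neg: "(\<lambda>x. - P x) \<in> B" if "P \<in> B" for P
    using B_scale[OF that, of "-1"] by (simp add: minus)
  have S_B: "mulop s \<in> B" if "s \<in> S" for s using R_B assms(3) that by blast
  have pow: "s ^ n \<in> S" if "s \<in> S" for s n
    using that assms(5,6) by (induct n) auto
  show ?thesis
  proof (rule ore_setting.intro)
    show "vector_space scale" by (rule vs)
    show "\<exists>t\<in>S. \<exists>Q\<in>B. mulop t \<circ> P = Q \<circ> mulop s" if P: "P \<in> B" and s: "s \<in> S" for P s
    proof -
      obtain n where n: "P \<in> diff_ops scale n" using cl(4)[OF P] by blast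
      have "\<exists>Q\<in>B. mulop (s ^ Suc n) \<circ> P = Q \<circ> mulop s"
        by (rule left_ore_mulop[OF n P S_B[OF s] cl(1)]) (intro cl neg; assumption)+
      then show ?thesis using pow[OF s] by (rule bexI[where x = "s ^ Suc n"])
    qed
    show "\<exists>t\<in>S. \<exists>Q\<in>B. P \<circ> mulop t = mulop s \<circ> Q" if P: "P \<in> B" and s: "s \<in> S" for P s
    proof -
      obtain n where n: "P \<in> diff_ops scale n" using cl(4)[OF P] by blast
      have "\<exists>Q\<in>B. P \<circ> mulop (s ^ Suc n) = mulop s \<circ> Q"
        by (rule right_ore_mulop[OF n P S_B[OF s] cl(1)]) (intro cl neg; assumption)+
      then show ?thesis using pow[OF s] by (rule bexI[where x = "s ^ Suc n"])
    qed
    show "Vector_Spaces.linear scale scale P" if "P \<in> B" for P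
      using cl(4)[OF that] diff_ops_linear by blast
    show "s \<noteq> 0" if "s \<in> S" for s using that assms(4) by blast
  qed (use scale_mult cl(1) assms(5,6) in \<open>auto intro: cl(2,3) B_scale S_B\<close>)
qed

text \<open>\<open>R\<close> contains \<open>scale c 1\<close>, and multiplying by it is scaling by
  \<open>c\<close>.\<close>

lemma R_submodule_subspace:
  fixes scale :: "'k::field \<Rightarrow> 'a::field \<Rightarrow> 'a"
  assumes "k_algebra scale" "condition_A scale R B" "R_submodule R U0"
  shows "module.subspace scale U0"
proof -
  interpret vector_space scale using assms(1) by (simp add: k_algebra_def)
  have U0: "subgroup U0 (add_monoid (ring_of_type_algebra :: 'a ring))"
    and R_U0: "\<And>r u. r \<in> R \<Longrightarrow> u \<in> U0 \<Longrightarrow> r * u \<in> U0"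
    using assms(3) by (auto simp: R_submodule_def additive_subgroup_def)
  have "subring R (ring_of_type_algebra :: 'a ring)" "\<And>c r. r \<in> R \<Longrightarrow> scale c r \<in> R"
    using assms(2) by (simp_all add: condition_A_def)
  then have "scale c 1 \<in> R" for c
    using submonoid.one_closed[of R "ring_of_type_algebra :: 'a ring"]
    by (simp add: subring_def ring_of_type_algebra_simps)
  moreover have "scale c x = scale c 1 * x" for c x
    using assms(1) by (metis k_algebra_def mult_1)
  ultimately have "scale c x \<in> U0" if "x \<in> U0" for c x using R_U0 that by metis
  then show ?thesis
    unfolding subspace_def
    using subgroup.m_closed[OF U0] subgroup.one_closed[OF U0]
    by (simp add: ring_of_type_algebra_simps)
qed

text \<open>The quotient skew-field is determined up to isomorphism, so the fractional ideal is
  claimed in every model \<open>Q\<close>, with \<M> embedded by \<open>loc_embed\<close>. The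
  clause on scalars makes the ring isomorphism one of algebras over the ground field.\<close>

theorem proposition4p10:
  fixes scale :: "'k::field_char_0 \<Rightarrow> 'a::field \<Rightarrow> 'a"
    and R S U0 U :: "'a set"
    and B A \<M> \<D> :: "('a \<Rightarrow> 'a) set"
    and L0 L :: "'a \<Rightarrow> 'a"
  assumes "k_algebra scale"
    and "condition_A scale R B"
    and "S \<subseteq> R" and "0 \<notin> S" and "1 \<in> S" and "\<forall>s\<in>S. \<forall>t\<in>S. s * t \<in> S"
    and "A = localization S B"
    and "R_submodule R U0"
    and "B = transporter A U0 U0"
    and "L0 \<in> B" and "locally_ad_nilpotent B L0"
    and "L \<in> A"
    and "admissible scale S U0 L U"
    and "L \<in> filt L0 S B 0" and "sigma0 scale L0 S B L = sigma0 scale L0 S B L0"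
    and "two_sided_noetherian (sub_ring_on scale B)"
    and "\<forall>V. admissible scale S U0 L V \<longrightarrow> V \<subseteq> U"
    and "\<M> = transporter A U0 U"
    and "\<D> = transporter A U U"
  shows "(\<forall>(Q :: 'q ring) \<iota>. quotient_skew_field (sub_ring_on scale B) Q \<iota> \<longrightarrow>
            fractional_right_ideal (sub_ring_on scale B) Q \<iota> (loc_embed S B Q \<iota> ` \<M>)) \<and>
         reflexive_right_module (sub_ring_on scale B)
            (right_mult_module (sub_ring_on scale A) \<M>) \<and>
         (\<exists>\<Phi> \<in> ring_iso (sub_ring_on scale \<D>)
                  (End_ring (sub_ring_on scale B) (right_mult_module (sub_ring_on scale A) \<M>)).
            \<forall>c. \<forall>P\<in>\<D>. \<Phi> (op_scale scale c P) = (\<lambda>m\<in>\<M>. op_scale scale c (\<Phi> P m)))"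
proof -
  let ?B = "sub_ring_on scale B" and ?M = "right_mult_module (sub_ring_on scale A) \<M>"
  interpret ore_setting scale S B
    using condition_A_ore_setting assms(1-6) by blast
  have "\<exists>n. P \<in> diff_ops scale n" if "P \<in> B" for P
    using subring_diff_ring(4)[of B scale P] assms(2) that by (simp add: condition_A_def)
  then have domain: "P \<circ> Q \<noteq> (\<lambda>x. 0)"
    if "P \<in> B" "Q \<in> B" "P \<noteq> (\<lambda>x. 0)" "Q \<noteq> (\<lambda>x. 0)" for P Q
    using diff_ops_comp_nonzero[OF k_algebra_char_0[OF vector_space]] that by blast
  interpret degree_setting scale S B L0
    by unfold_locales (use assms(10,11) domain k_algebra_char_0[OF vector_space] in auto)
  obtain s where s: "s \<in> S" "mulop s ` U0 \<subseteq> U" "U \<subseteq> mulop (inverse s) ` U0"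
    and U: "vs.subspace U" "L ` U \<subseteq> U"
    using assms(13) unfolding admissible_def by blast
  interpret maximal_setting scale S B L0 U0 U L s
  proof
    show "B = transporter (localization S B) U0 U0" using assms(7,9) by simp
    show "vs.subspace U0" using R_submodule_subspace assms(1,2,8) by blast
    show "s * x \<in> U" if "x \<in> U0" for x using s(2) that by (auto simp: mulop_def)
    show "s * x \<in> U0" if "x \<in> U" for x
    proof -
      have "x \<in> mulop (inverse s) ` U0" using s(3) that by blast
      then obtain y where "y \<in> U0" "x = inverse s * y" by (auto simp: mulop_def)
      then show ?thesis using S_nonzero[OF s(1)] by (simp add: mult.assoc[symmetric])
    qed
    show "L \<in> localization S B" using assms(7,12) by simp
    show "deg_le (\<lambda>x. L x - L0 x) (- 1)" using sigma0_eq_imp_deg_le assms(15) by blast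
    show "V \<subseteq> U" if "admissible scale S U0 L V" for V using assms(17) that by blast
  qed (use s(1) U in auto)
  have M: "\<M> = M" and D: "\<D> = D" using assms(7,18,19) by simp_all
  have "fractional_right_ideal ?B Q \<iota> (loc_embed S B Q \<iota> ` \<M>)"
    if "quotient_skew_field ?B Q \<iota>" for Q :: "'q ring" and \<iota>
    unfolding M by (rule fractional_right_ideal_loc_embed[OF that right_submodule_M s_S s_M s_dual])
  moreover have "reflexive_right_module ?B ?M"
    unfolding M assms(7)
    by (rule reflexive_right_submodule[OF right_submodule_M s_S s_M s_dual bidual_subset_M])
  moreover have "left_mult \<M> \<in> ring_iso (sub_ring_on scale \<D>) (End_ring ?B ?M)"
    unfolding M D assms(7)
    by (rule End_ring_iso[OF right_submodule_M s_S s_M End_M_eq_D[symmetric]])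
  moreover have "left_mult \<M> (op_scale scale c P) = (\<lambda>m\<in>\<M>. op_scale scale c (left_mult \<M> P m))" for c P
    by (auto simp: left_mult_def op_scale_def fun_eq_iff)
  ultimately show ?thesis by blast
qed

end
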